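(* For every tree $T$, $$\mathrm{ex}(n,K_3,T^{\triangle})=\left|\mathcal{S}_{\mathrm{bi}}(n,\sigma(T)-1)\right|+o(n^2).$$
   Context: For a graph $F$, $|F|$ is its number of edges and $F-I$ the subgraph induced on $V(F)\setminus I$. The crosscut number is $\sigma(F)=\min\{|I|+|F-I| : I \text{ independent in } F\}$. The $\triangle$-blowup $F^{\triangle}$ of a graph $F$ is obtained by replacing each edge $uv$ by a triangle $uvw_{uv}$ with a new vertex $w_{uv}$, distinct edges receiving distinct new vertices. $\mathrm{ex}(n,K_3,F^{\triangle})$ is the maximum number of triangles in an $n$-vertex graph with no copy of $F^{\triangle}$. $T(m)$ is the balanced complete bipartite graph on $m$ vertices, $S(n,t)=K_t\vee T(n-t)$ is the join of $K_t$ and $T(n-t)$, and $\mathcal{S}_{\mathrm{bi}}(n,t)$ is the set of triangles (vertex triples inducing $K_3$) of $S(n,t)$. *)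

theory Defs
  imports Main "HOL-Library.Landau_Symbols"
begin

definition graph :: "'a set \<Rightarrow> 'a set set \<Rightarrow> bool" where
  "graph V E \<longleftrightarrow> (\<forall>e\<in>E. e \<subseteq> V \<and> card e = 2)"

definition walk :: "'a set set \<Rightarrow> 'a list \<Rightarrow> bool" where
  "walk E xs \<longleftrightarrow> xs \<noteq> [] \<and> (\<forall>i. Suc i < length xs \<longrightarrow> {xs ! i, xs ! Suc i} \<in> E)"

definition connected_graph :: "'a set \<Rightarrow> 'a set set \<Rightarrow> bool" where
  "connected_graph V E \<longleftrightarrow>
     (\<forall>u\<in>V. \<forall>v\<in>V. \<exists>xs. walk E xs \<and> set xs \<subseteq> V \<and> hd xs = u \<and> last xs = v)"

definition has_cycle :: "'a set set \<Rightarrow> bool" where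
  "has_cycle E \<longleftrightarrow> (\<exists>xs. length xs \<ge> 3 \<and> distinct xs \<and> walk E xs \<and> {last xs, hd xs} \<in> E)"

definition tree :: "'a set \<Rightarrow> 'a set set \<Rightarrow> bool" where
  "tree V E \<longleftrightarrow> finite V \<and> V \<noteq> {} \<and> graph V E \<and> connected_graph V E \<and> \<not> has_cycle E"

definition independent :: "'a set \<Rightarrow> 'a set set \<Rightarrow> 'a set \<Rightarrow> bool" where
  "independent V E I \<longleftrightarrow> I \<subseteq> V \<and> (\<forall>x\<in>I. \<forall>y\<in>I. {x, y} \<notin> E)"

definition crosscut :: "'a set \<Rightarrow> 'a set set \<Rightarrow> nat" where
  "crosscut V E = Min {card I + card {e \<in> E. e \<inter> I = {}} | I. independent V E I}"

definition tri_blowup_V :: "'a set \<Rightarrow> 'a set set \<Rightarrow> ('a + 'a set) set" where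
  "tri_blowup_V V E = Inl ` V \<union> Inr ` E"

definition tri_blowup_E :: "'a set \<Rightarrow> 'a set set \<Rightarrow> ('a + 'a set) set set" where
  "tri_blowup_E V E = (\<Union>e\<in>E. {Inl ` e} \<union> (\<lambda>x. {Inl x, Inr e}) ` e)"

definition contains_copy :: "'b set \<Rightarrow> 'b set set \<Rightarrow> 'c set \<Rightarrow> 'c set set \<Rightarrow> bool" where
  "contains_copy VF EF VG EG \<longleftrightarrow>
     (\<exists>f. inj_on f VF \<and> f ` VF \<subseteq> VG \<and> (\<forall>e\<in>EF. f ` e \<in> EG))"

definition triangles :: "'c set \<Rightarrow> 'c set set \<Rightarrow> 'c set set" where
  "triangles V E = {t. t \<subseteq> V \<and> card t = 3 \<and> (\<forall>x\<in>t. \<forall>y\<in>t. x \<noteq> y \<longrightarrow> {x, y} \<in> E)}"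

definition ex_K3 :: "nat \<Rightarrow> 'b set \<Rightarrow> 'b set set \<Rightarrow> nat" where
  "ex_K3 n VF EF = Max {card (triangles {..<n} E) | E. graph {..<n} E \<and> \<not> contains_copy VF EF {..<n} E}"

text \<open>S(n,t) = K_t join T(n-t) on {0..<n}: clique {0..<t}, parts A = {t..<t+(n-t) div 2} and B = rest.\<close>
definition S_edges :: "nat \<Rightarrow> nat \<Rightarrow> nat set set" where
  "S_edges n t = (let A = {t..<t + (n - t) div 2}; B = {t + (n - t) div 2..<n} in
     {{x, y} | x y. x < n \<and> y < n \<and> x \<noteq> y \<and> \<not> (x \<in> A \<and> y \<in> A) \<and> \<not> (x \<in> B \<and> y \<in> B)})"

definition S_bi :: "nat \<Rightarrow> nat \<Rightarrow> nat set set" where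
  "S_bi n t = triangles {..<n} (S_edges n t)"

end

theory Submission
  imports Defs
begin

text \<open>
  Copies of the blowup of \<open>T\<close> in a graph are copies of the 3-uniform expansion of \<open>T\<close> in its
  triangle system \<open>H\<close>. Write \<open>\<sigma>\<close> for the crosscut number.

  Lower bound: replacing \<open>K\<^sub>t\<close> by an independent set in \<open>S(n,t)\<close> costs only \<open>O(n)\<close> triangles, and for
  \<open>t < \<sigma>\<close> the resulting complete tripartite graph contains no blowup: the tree vertices placed in
  the small part are independent, and every edge of \<open>T\<close> missing them needs its own apex there.

  Upper bound: let \<open>H\<close> contain no copy. A subsystem in which all pairs have large codegree would
  contain one greedily, so \<open>H\<close> has \<open>O(n\<^sup>2)\<close> triples. Hence all but \<open>o(n\<^sup>2)\<close> pairs of the shadow have bounded codegree,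
  and a graph whose edges lie in boundedly many triangles has at most \<open>n\<^sup>2/4 + O(n)\<close> edges.
  So if \<open>H\<close> has \<open>\<epsilon>n\<^sup>2\<close> triples too many, deleting pairs of codegree less than \<open>\<sigma>\<close> leaves a
  subsystem with a dense shadow in which all codegrees are at least \<open>\<sigma>\<close>. Its shadow contains a large
  grid \<open>X \<times> Y\<close>, and Ramsey-type thinning yields one of three configurations.
  (1) Many vertices \<open>u\<close> whose third vertices \<open>t(u,y)\<close> are distinct for distinct \<open>y \<in> Y\<close>, while each
  \<open>y\<close> has the same property towards these \<open>u\<close>: every new tree vertex then chooses its own apex.
  (2) A complete tripartite system with parts of size \<open>\<sigma>\<close>, large, large: an optimal \<open>I\<close>, and the apexes of
  the edges missing \<open>I\<close>, go to the small part.
  (3) A graph of minimum degree \<open>\<sigma>\<close> in the common link of \<open>Y\<close> with many disjoint edges: put \<open>I\<close>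
  and the apexes of the edges missing \<open>I\<close> into \<open>Y\<close>. What remains to be embedded is a forest which
  has only \<open>\<sigma> - 1\<close> edges beyond one edge per component, so the greedy choice never gets stuck.
\<close>

section \<open>Rooted trees and greedy embedding\<close>

text \<open>Trees as they arise by attaching leaves; every embedding below is an induction along
  this order. The root \<open>r\<close> is a parameter because \<open>layered_embeds\<close> has to
  start inside the independent set \<open>I\<close>.\<close>

inductive rooted :: "'a \<Rightarrow> 'a set \<Rightarrow> 'a set set \<Rightarrow> bool" for r where
  root: "rooted r {r} {}"
| leaf: "rooted r V E \<Longrightarrow> u \<in> V \<Longrightarrow> v \<notin> V \<Longrightarrow> rooted r (insert v V) (insert {u, v} E)"

lemma rooted_graph:
  assumes "rooted r V E"
  shows "r \<in> V" "finite V" "finite E" "graph V E" "card V = card E + 1"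
proof -
  have "r \<in> V \<and> finite V \<and> finite E \<and> graph V E \<and> card V = card E + 1"
    using assms
  proof induction
    case (leaf V E u v)
    then have "{u, v} \<notin> E" by (auto simp: graph_def)
    moreover have "card {u, v} = 2" using leaf by (auto simp: card_2_iff)
    ultimately show ?case using leaf by (auto simp: graph_def)
  qed (auto simp: graph_def)
  then show "r \<in> V" "finite V" "finite E" "graph V E" "card V = card E + 1" by auto
qed

lemma walk_Cons:
  assumes "walk E xs" "{x, hd xs} \<in> E"
  shows "walk E (x # xs)"
  unfolding walk_def
proof (intro conjI allI impI)
  fix i assume "Suc i < length (x # xs)"
  with assms show "{(x # xs) ! i, (x # xs) ! Suc i} \<in> E"
    by (cases i) (auto simp: walk_def hd_conv_nth)
qed simp

lemma walk_snoc:
  assumes "walk E xs" "{last xs, x} \<in> E"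
  shows "walk E (xs @ [x])"
  unfolding walk_def
proof (intro conjI allI impI)
  fix i assume "Suc i < length (xs @ [x])"
  then consider "Suc i < length xs" | "Suc i = length xs" by fastforce
  then show "{(xs @ [x]) ! i, (xs @ [x]) ! Suc i} \<in> E"
  proof cases
    case 1 with assms show ?thesis by (auto simp: walk_def nth_append)
  next
    case 2
    then have "last xs = xs ! i" by (metis diff_Suc_1 last_conv_nth list.size(3) nat.distinct(1))
    with 2 assms show ?thesis by (auto simp: nth_append)
  qed
qed simp

lemma walk_mono: "walk E xs \<Longrightarrow> E \<subseteq> F \<Longrightarrow> walk F xs"
  by (auto simp: walk_def)

lemma rooted_path:
  assumes "rooted r V E" "a \<in> V" "b \<in> V"
  shows "\<exists>xs. distinct xs \<and> walk E xs \<and> set xs \<subseteq> V \<and> hd xs = a \<and> last xs = b"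
  using assms
proof (induction arbitrary: a b)
  case root
  then show ?case by (intro exI[of _ "[r]"]) (auto simp: walk_def)
next
  case (leaf V E u v)
  let ?E = "insert {u, v} E"
  consider "a = v" "b = v" | "a = v" "b \<in> V" | "a \<in> V" "b = v" | "a \<in> V" "b \<in> V"
    using leaf.prems by auto
  then show ?case
  proof cases
    case 1 then show ?thesis by (intro exI[of _ "[v]"]) (auto simp: walk_def)
  next
    case 2
    with leaf.IH[of u b] leaf.hyps obtain xs
      where xs: "distinct xs" "walk E xs" "set xs \<subseteq> V" "hd xs = u" "last xs = b"
      by blast
    moreover have "walk ?E (v # xs)"
      using xs by (intro walk_Cons walk_mono[OF xs(2)]) (auto simp: insert_commute)
    ultimately show ?thesis using leaf.hyps 2
      by (intro exI[of _ "v # xs"]) (auto simp: walk_def)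
  next
    case 3
    with leaf.IH[of a u] leaf.hyps obtain xs
      where xs: "distinct xs" "walk E xs" "set xs \<subseteq> V" "hd xs = a" "last xs = u"
      by blast
    moreover have "walk ?E (xs @ [v])"
      using xs by (intro walk_snoc walk_mono[OF xs(2)]) auto
    ultimately show ?thesis using leaf.hyps 3
      by (intro exI[of _ "xs @ [v]"]) (auto simp: walk_def)
  next
    case 4
    with leaf.IH[of a b] obtain xs
      where "distinct xs" "walk E xs" "set xs \<subseteq> V" "hd xs = a" "last xs = b"
      by blast
    then show ?thesis using walk_mono[of E xs ?E] by (intro exI[of _ xs]) auto
  qed
qed

lemma walk_leaves:
  assumes "walk E xs" "hd xs \<in> S" "last xs \<notin> S"
  shows "\<exists>u v. {u, v} \<in> E \<and> u \<in> S \<and> v \<notin> S \<and> v \<in> set xs"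
proof (rule ccontr)
  assume *: "\<not> ?thesis"
  have "xs ! i \<in> S" if "i < length xs" for i
    using that
  proof (induction i)
    case 0 then show ?case using assms by (auto simp: walk_def hd_conv_nth)
  next
    case (Suc i)
    with assms have "{xs ! i, xs ! Suc i} \<in> E" by (auto simp: walk_def)
    with Suc * show ?case by (meson Suc_lessD nth_mem)
  qed
  moreover have "xs \<noteq> []" using assms by (auto simp: walk_def)
  ultimately show False using assms by (auto simp: last_conv_nth)
qed

text \<open>A largest rooted subtree is everything: connectedness gives an edge leaving a proper
  vertex set, and a missed edge would close a cycle with the path from
  \<open>rooted_path\<close>.\<close>

lemma tree_rooted:
  assumes "tree V E" "r \<in> V"
  shows "rooted r V E"
proof -
  have fin: "finite V" and gr: "graph V E" and con: "connected_graph V E" and acyc: "\<not> has_cycle E"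
    using assms by (auto simp: tree_def)
  let ?P = "\<lambda>S. \<exists>F. rooted r S F \<and> S \<subseteq> V \<and> F \<subseteq> E"
  have "?P {r}" using assms by (auto intro: rooted.root)
  moreover have "\<forall>S. ?P S \<longrightarrow> card S < Suc (card V)"
    using fin by (auto simp: less_Suc_eq_le card_mono)
  ultimately obtain S where "?P S" and max: "\<And>S'. ?P S' \<Longrightarrow> card S' \<le> card S"
    using ex_has_greatest_nat[of ?P "{r}" card "Suc (card V)"] by blast
  then obtain F where F: "rooted r S F" "S \<subseteq> V" "F \<subseteq> E" by blast
  have "S = V"
  proof (rule ccontr)
    assume "S \<noteq> V"
    with F obtain b where b: "b \<in> V" "b \<notin> S" by blast
    from con assms(2) b(1) obtain xs where xs: "walk E xs" "set xs \<subseteq> V" "hd xs = r" "last xs = b"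
      unfolding connected_graph_def by blast
    with b rooted_graph(1)[OF F(1)] obtain u v where "{u, v} \<in> E" "u \<in> S" "v \<notin> S" "v \<in> set xs"
      using walk_leaves[of E xs S] by blast
    with xs F have "rooted r (insert v S) (insert {u, v} F) \<and> insert v S \<subseteq> V \<and> insert {u, v} F \<subseteq> E"
      by (auto intro: rooted.leaf)
    then have "?P (insert v S)" by blast
    from max[OF this] \<open>v \<notin> S\<close> rooted_graph(2)[OF F(1)] show False by simp
  qed
  moreover have "F = E"
  proof (rule ccontr)
    assume "F \<noteq> E"
    with F obtain e where e: "e \<in> E" "e \<notin> F" by blast
    with gr obtain a b where ab: "e = {a, b}" "a \<noteq> b" "a \<in> V" "b \<in> V"
      by (auto simp: graph_def card_2_iff)
    with F \<open>S = V\<close> obtain xs where xs: "distinct xs" "walk F xs" "hd xs = a" "last xs = b"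
      using rooted_path[of r S F a b] by blast
    \<comment> \<open>A nonempty path with at most two vertices would mean \<open>a = b\<close> or
      \<open>e \<in> F\<close>.\<close>
    have "length xs \<ge> 3"
    proof (rule ccontr)
      assume "\<not> ?thesis"
      then consider "length xs = 0" | "length xs = 1" | "length xs = 2" by linarith
      then show False
      proof cases
        case 1 with xs show ?thesis by (simp add: walk_def)
      next
        case 2
        then obtain x where "xs = [x]" by (metis One_nat_def length_0_conv length_Suc_conv)
        with xs ab show ?thesis by simp
      next
        case 3
        then have "{xs ! 0, xs ! 1} \<in> F" "xs \<noteq> []" using xs by (auto simp: walk_def)
        then show False using 3 xs ab e by (auto simp: hd_conv_nth last_conv_nth)
      qed
    qed
    moreover have "walk E xs" using walk_mono[of F xs E] xs F by blast
    moreover have "{last xs, hd xs} \<in> E" using xs e ab by (simp add: insert_commute)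
    ultimately show False using acyc xs by (auto simp: has_cycle_def)
  qed
  ultimately show ?thesis using F by simp
qed

section \<open>Copies of the expansion and their greedy extension\<close>

text \<open>These are the copies in \<open>H\<close> of the 3-uniform expansion, with
  \<open>Inr e\<close> as the apex over the edge \<open>e\<close>.\<close>

definition embeds :: "'a set \<Rightarrow> 'a set set \<Rightarrow> 'b set set \<Rightarrow> ('a + 'a set \<Rightarrow> 'b) \<Rightarrow> bool" where
  "embeds V E H h \<longleftrightarrow>
     inj_on h (tri_blowup_V V E) \<and> (\<forall>e\<in>E. h ` insert (Inr e) (Inl ` e) \<in> H)"

text \<open>The extension step of every embedding below. The values of \<open>h'\<close> on old and
  new points belong to the result because the later inductions carry invariants about them.\<close>

lemma embeds_leaf:
  assumes "embeds V E H h" "graph V E" "u \<in> V" "v \<notin> V"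
    and "b \<notin> h ` tri_blowup_V V E" "c \<notin> h ` tri_blowup_V V E" "b \<noteq> c" "{h (Inl u), b, c} \<in> H"
  obtains h' where "embeds (insert v V) (insert {u, v} E) H h'"
    "\<And>w. w \<in> V \<Longrightarrow> h' (Inl w) = h (Inl w)" "\<And>e. e \<in> E \<Longrightarrow> h' (Inr e) = h (Inr e)"
    "h' (Inl v) = b" "h' (Inr {u, v}) = c"
proof
  let ?h = "h(Inl v := b, Inr {u, v} := c)"
  have E: "{u, v} \<notin> E" using assms by (auto simp: graph_def)
  show V: "\<And>w. w \<in> V \<Longrightarrow> ?h (Inl w) = h (Inl w)" and "\<And>e. e \<in> E \<Longrightarrow> ?h (Inr e) = h (Inr e)"
    "?h (Inl v) = b" "?h (Inr {u, v}) = c"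
    using assms E by auto
  have B: "tri_blowup_V (insert v V) (insert {u, v} E)
             = insert (Inl v) (insert (Inr {u, v}) (tri_blowup_V V E))"
    by (auto simp: tri_blowup_V_def)
  have n: "Inl v \<notin> tri_blowup_V V E" "Inr {u, v} \<notin> tri_blowup_V V E"
    using assms E by (auto simp: tri_blowup_V_def)
  have eq: "?h z = h z" if "z \<in> tri_blowup_V V E" for z using that n by auto
  have img: "?h ` tri_blowup_V V E = h ` tri_blowup_V V E"
    using eq by (rule image_cong[OF refl])
  have "inj_on ?h (tri_blowup_V V E) \<longleftrightarrow> inj_on h (tri_blowup_V V E)"
    using eq by (rule inj_on_cong)
  then have "inj_on ?h (tri_blowup_V V E)"
    using assms(1) by (simp add: embeds_def)
  with img have "inj_on ?h (tri_blowup_V (insert v V) (insert {u, v} E))"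
    unfolding B using assms n by simp
  moreover have "?h ` insert (Inr e) (Inl ` e) \<in> H" if "e \<in> E" for e
  proof -
    have "insert (Inr e) (Inl ` e) \<subseteq> tri_blowup_V V E"
      using that assms(2) by (auto simp: tri_blowup_V_def graph_def)
    then have "?h ` insert (Inr e) (Inl ` e) = h ` insert (Inr e) (Inl ` e)"
      using eq by (intro image_cong refl) blast
    then show ?thesis using assms(1) that by (auto simp: embeds_def)
  qed
  moreover have "?h ` insert (Inr {u, v}) (Inl ` {u, v}) = {h (Inl u), b, c}"
    using assms by auto
  ultimately show "embeds (insert v V) (insert {u, v} E) H ?h"
    using assms(8) unfolding embeds_def by (metis (no_types, lifting) insertE)
qed

lemma card_tri_blowup_V:
  assumes "finite V" "finite E"
  shows "card (tri_blowup_V V E) = card V + card E"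
  unfolding tri_blowup_V_def using assms
  by (subst card_Un_disjoint) (auto simp: card_image)

text \<open>A partial copy has \<open>2 * card V' - 1\<close> vertices, so it is enough to avoid
  sets \<open>U\<close> of fewer than \<open>2 * card V\<close> used vertices. The flag
  \<open>\<kappa>\<close> flips along each tree edge; it allows tree vertices to alternate between
  the two sides of a grid.\<close>

lemma embeds_greedy:
  fixes H :: "'b set set"
  assumes "rooted r V E" "good \<kappa> a"
    and ext: "\<And>\<kappa> a U. good \<kappa> a \<Longrightarrow> finite U \<Longrightarrow> card U < 2 * card V \<Longrightarrow>
      \<exists>b c. b \<notin> U \<and> c \<notin> U \<and> b \<noteq> c \<and> good (\<not> \<kappa>) b \<and> {a, b, c} \<in> H"
  shows "\<exists>h. embeds V E H h"
proof -
  have "\<exists>h. embeds V' E' H h \<and> (\<forall>v\<in>V'. \<exists>\<kappa>. good \<kappa> (h (Inl v)))"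
    if "rooted r V' E'" "card V' \<le> card V" for V' E'
    using that
  proof induction
    case root
    show ?case
      by (intro exI[of _ "\<lambda>_. a"]) (use assms in \<open>auto simp: embeds_def tri_blowup_V_def\<close>)
  next
    case (leaf V' E' u v)
    note g = rooted_graph[OF leaf.hyps(1)]
    have le: "Suc (card V') \<le> card V" using leaf g by simp
    then obtain h where h: "embeds V' E' H h" "\<forall>v\<in>V'. \<exists>\<kappa>. good \<kappa> (h (Inl v))"
      using leaf by auto
    from h leaf obtain \<kappa> where k: "good \<kappa> (h (Inl u))" by blast
    let ?U = "h ` tri_blowup_V V' E'"
    have fU: "finite ?U" using g by (auto simp: tri_blowup_V_def)
    have "card ?U \<le> card V' + card E'"
      using card_image_le[of "tri_blowup_V V' E'" h] card_tri_blowup_V[OF g(2,3)] g(2,3)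
      by (simp add: tri_blowup_V_def)
    then have "card ?U < 2 * card V" using g le by simp
    from ext[OF k fU this] obtain b c where bc:
      "b \<notin> ?U" "c \<notin> ?U" "b \<noteq> c" "good (\<not> \<kappa>) b" "{h (Inl u), b, c} \<in> H" by blast
    from embeds_leaf[OF h(1) g(4) leaf(2,3) bc(1-3,5)] obtain h' where h':
      "embeds (insert v V') (insert {u, v} E') H h'"
      "\<And>w. w \<in> V' \<Longrightarrow> h' (Inl w) = h (Inl w)" "h' (Inl v) = b" by metis
    with h bc show ?case by (intro exI[of _ h']) auto
  qed
  with assms(1) show ?thesis by blast
qed

section \<open>Thinning one side of a grid\<close>

text \<open>Either \<open>t\<close> takes at least \<open>s\<close> values, and representatives give
  an injective restriction, or some fibre has at least \<open>s\<close> points.\<close>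

lemma const_or_inj:
  assumes "finite Y" "s * s \<le> card Y"
  shows "\<exists>Z\<subseteq>Y. card Z = s \<and> (inj_on t Z \<or> (\<exists>c. \<forall>y\<in>Z. t y = c))"
proof (cases "s \<le> card (t ` Y)")
  case True
  obtain Y' where Y': "Y' \<subseteq> Y" "inj_on t Y'" "t ` Y = t ` Y'"
    using subset_image_inj[of "t ` Y" t Y] by blast
  then have "s \<le> card Y'" using True card_image by metis
  then obtain Z where "Z \<subseteq> Y'" "card Z = s" by (meson obtain_subset_with_card_n)
  then have "Z \<subseteq> Y \<and> card Z = s \<and> inj_on t Z"
    using Y' inj_on_subset by blast
  then show ?thesis by blast
next
  case False
  show ?thesis
  proof (cases "\<exists>c. s \<le> card {y \<in> Y. t y = c}")
    case True
    then obtain c Z where "Z \<subseteq> {y \<in> Y. t y = c}" "card Z = s"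
      by (meson obtain_subset_with_card_n)
    then have "Z \<subseteq> Y" "\<forall>y\<in>Z. t y = c" by auto
    with \<open>card Z = s\<close> show ?thesis by blast
  next
    case small: False
    have "card Y = (\<Sum>c\<in>t ` Y. card {y \<in> Y. t y = c})"
      using card_eq_sum sum.image_gen[OF assms(1), of "\<lambda>_. 1::nat" t] by simp
    also have "\<dots> \<le> (\<Sum>c\<in>t ` Y. s)"
      using small by (intro sum_mono) (simp add: less_imp_le not_le)
    also have "\<dots> = card (t ` Y) * s" by simp
    also have "\<dots> < s * s" using False by (intro mult_strict_right_mono) auto
    finally show ?thesis using assms by simp
  qed
qed

section \<open>Triple systems with large codegrees\<close>

definition triple_system :: "'b set set \<Rightarrow> bool" where
  "triple_system H \<longleftrightarrow> finite H \<and> (\<forall>t\<in>H. card t = 3)"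

text \<open>Its size is the codegree of \<open>a\<close> and \<open>b\<close>. In a triple system it
  is empty for \<open>a = b\<close> and contains neither \<open>a\<close> nor \<open>b\<close>,
  since \<open>{a, b, c}\<close> must have three elements.\<close>

definition colink :: "'b set set \<Rightarrow> 'b \<Rightarrow> 'b \<Rightarrow> 'b set" where
  "colink H a b = {c. {a, b, c} \<in> H}"

definition full :: "nat \<Rightarrow> 'b set set \<Rightarrow> bool" where
  "full d H \<longleftrightarrow> (\<forall>a b. colink H a b \<noteq> {} \<longrightarrow> d \<le> card (colink H a b))"

lemma triple_distinct:
  assumes "triple_system H" "{a, b, c} \<in> H"
  shows "a \<noteq> b" "a \<noteq> c" "b \<noteq> c"
proof -
  have c: "card {a, b, c} = 3" using assms by (auto simp: triple_system_def)
  show "a \<noteq> b" "a \<noteq> c" "b \<noteq> c" using c by (auto simp: card_insert_if split: if_splits)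
qed

lemma finite_colink:
  assumes "triple_system H"
  shows "finite (colink H a b)"
proof (rule finite_subset)
  show "colink H a b \<subseteq> \<Union>H" by (auto simp: colink_def)
  have "finite t" if "t \<in> H" for t
    using assms that by (intro card_ge_0_finite) (auto simp: triple_system_def)
  then show "finite (\<Union>H)" using assms by (auto simp: triple_system_def)
qed

lemma colink_commute: "colink H a b = colink H b a"
  by (simp add: colink_def insert_commute)

lemma ex_fresh:
  assumes "finite U" "card U < card (A::'b set)"
  shows "\<exists>a\<in>A. a \<notin> U"
  using assms by (meson card_mono linorder_not_le subsetI)

text \<open>From \<open>a\<close> in a triple \<open>{a, b0, c0}\<close> the large codegree is used
  twice: for \<open>a\<close>, \<open>b0\<close> it gives a fresh \<open>b\<close>; since the triple
  \<open>{a, b0, b}\<close> covers \<open>a\<close> and \<open>b\<close>, it then gives a fresh apex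
  \<open>c\<close> for this pair.\<close>

lemma full_embeds:
  fixes H :: "'a set set"
  assumes "triple_system H" "full d H" "H \<noteq> {}" "rooted r V E" "2 * card V \<le> d"
  shows "\<exists>h. embeds V E H h"
proof -
  have out: "\<And>a b U. colink H a b \<noteq> {} \<Longrightarrow> finite U \<Longrightarrow> card U < 2 * card V \<Longrightarrow> \<exists>c. c \<in> colink H a b \<and> c \<notin> U"
  proof -
    fix a b and U :: "'a set"
    assume that: "colink H a b \<noteq> {}" "finite U" "card U < 2 * card V"
    have "card U < card (colink H a b)"
      using that assms unfolding full_def by (meson less_le_trans order_trans)
    with that show "\<exists>c. c \<in> colink H a b \<and> c \<notin> U" using ex_fresh[of U "colink H a b"] by blast
  qed
  obtain t where t: "t \<in> H" using assms by blast
  then have "card t = 3" using assms by (auto simp: triple_system_def)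
  then obtain a where "a \<in> t" by fastforce
  with t have a: "a \<in> \<Union>H" by blast
  show ?thesis
  proof (rule embeds_greedy[OF assms(4), of "\<lambda>_ a. a \<in> \<Union>H", OF a])
    fix a and U :: "'a set" assume "a \<in> \<Union>H" and U: "finite U" "card U < 2 * card V"
    then obtain t where t: "t \<in> H" "a \<in> t" by blast
    then have "card t = 3" using assms by (auto simp: triple_system_def)
    then obtain b0 c0 where "t = {a, b0, c0}"
      using t(2) by (auto simp: card_3_iff)
    then have "colink H a b0 \<noteq> {}" using t by (auto simp: colink_def)
    from out[OF this U] obtain b where b: "{a, b0, b} \<in> H" "b \<notin> U" by (auto simp: colink_def)
    then have "b0 \<in> colink H a b" by (simp add: colink_def insert_commute)
    then have "colink H a b \<noteq> {}" by blast
    from out[OF this U] obtain c where c: "{a, b, c} \<in> H" "c \<notin> U" by (auto simp: colink_def)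
    with b triple_distinct[OF assms(1) c(1)]
    show "\<exists>b c. b \<notin> U \<and> c \<notin> U \<and> b \<noteq> c \<and> b \<in> \<Union>H \<and> {a, b, c} \<in> H" by blast
  qed
qed

section \<open>Rich and common vertices over a set\<close>

definition rich :: "'b set set \<Rightarrow> 'b \<Rightarrow> 'b set \<Rightarrow> bool" where
  "rich H u Y \<longleftrightarrow> (\<exists>t. inj_on t Y \<and> (\<forall>y\<in>Y. {u, y, t y} \<in> H))"

text \<open>Thus \<open>u\<close> has at least \<open>d\<close> neighbours in the common link of
  \<open>Y\<close>, the graph of all pairs that form a triple with every
  \<open>y \<in> Y\<close>.\<close>

definition common :: "nat \<Rightarrow> 'b set set \<Rightarrow> 'b \<Rightarrow> 'b set \<Rightarrow> bool" where
  "common d H u Y \<longleftrightarrow> (\<exists>C. finite C \<and> card C = d \<and> (\<forall>c\<in>C. \<forall>y\<in>Y. {u, c, y} \<in> H))"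

lemma rich_mono: "rich H u Y \<Longrightarrow> Z \<subseteq> Y \<Longrightarrow> rich H u Z"
  unfolding rich_def using inj_on_subset by blast

lemma common_mono: "common d H u Y \<Longrightarrow> Z \<subseteq> Y \<Longrightarrow> common d H u Z"
  unfolding common_def by blast

text \<open>The set \<open>C\<close> grows by one vertex at a time. While \<open>card C < d\<close>,
  each \<open>y\<close> has a third vertex \<open>t y\<close> outside \<open>C\<close>; by
  \<open>const_or_inj\<close> this choice becomes injective, which is \<open>rich\<close>, or
  constant, which extends \<open>C\<close>. Every round costs a square root of the size.\<close>

lemma rich_or_common_step:
  assumes "triple_system H" "\<forall>y\<in>Y. d \<le> card (colink H u y)" "finite Y" "k \<le> d"
    "s ^ (2 ^ k) \<le> card Y"
  shows "\<exists>Z\<subseteq>Y. card Z = s \<and> (rich H u Z \<or> common k H u Z)"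
  using assms(4,5)
proof (induction k arbitrary: s)
  case 0
  then have "s \<le> card Y" by simp
  then obtain Z where "Z \<subseteq> Y" "card Z = s" by (rule obtain_subset_with_card_n)
  moreover have "common 0 H u Z" unfolding common_def by (rule exI[of _ "{}"]) simp
  ultimately show ?case by blast
next
  case (Suc k)
  have "(s * s) ^ (2 ^ k) \<le> card Y"
    using Suc.prems(2) by (simp add: power_mult power2_eq_square)
  with Suc.IH[of "s * s"] Suc.prems(1) obtain Z
    where Z: "Z \<subseteq> Y" "card Z = s * s" "rich H u Z \<or> common k H u Z"
    by auto
  have fZ: "finite Z" using Z assms finite_subset by blast
  show ?case
  proof (cases "rich H u Z")
    case True
    have "s \<le> card Z" using Z(2) by simp
    then obtain W where "W \<subseteq> Z" "card W = s" by (rule obtain_subset_with_card_n)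
    with Z True show ?thesis using rich_mono[OF True, of W] by blast
  next
    case False
    with Z obtain C where C: "finite C" "card C = k" "\<forall>c\<in>C. \<forall>y\<in>Z. {u, c, y} \<in> H"
      by (auto simp: common_def)
    have "\<exists>c. c \<in> colink H u y \<and> c \<notin> C" if "y \<in> Z" for y
    proof -
      have "d \<le> card (colink H u y)" using that Z(1) assms(2) by blast
      then have "card C < card (colink H u y)" using Suc.prems(1) C(2) by simp
      then show ?thesis using ex_fresh[OF C(1)] by blast
    qed
    then obtain t where t: "\<forall>y\<in>Z. t y \<in> colink H u y \<and> t y \<notin> C" by metis
    from const_or_inj[OF fZ, of s t] Z obtain W where W: "W \<subseteq> Z" "card W = s"
      "inj_on t W \<or> (\<exists>c. \<forall>y\<in>W. t y = c)" by auto
    have "rich H u W \<or> common (Suc k) H u W"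
    proof (cases "inj_on t W")
      case True
      moreover have "\<forall>y\<in>W. {u, y, t y} \<in> H" using t W(1) by (auto simp: colink_def)
      ultimately show ?thesis unfolding rich_def by blast
    next
      case False
      with W obtain c where c: "\<forall>y\<in>W. t y = c" by blast
      \<comment> \<open>A non-injective \<open>t\<close> forces \<open>W\<close> to be nonempty, so
        the constant is attained as some \<open>t y\<close> and avoids \<open>C\<close>.\<close>
      from False obtain y where y: "y \<in> W" by (force simp: inj_on_def)
      then have "t y \<notin> C" using t W(1) by blast
      then have "c \<notin> C" using c y by simp
      moreover have "{u, c, y} \<in> H" if "y \<in> W" for y
      proof -
        have "t y \<in> colink H u y" "t y = c" using t c W(1) that by blast+
        then show ?thesis by (simp add: colink_def insert_commute)
      qed
      then have "\<forall>b\<in>insert c C. \<forall>y\<in>W. {u, b, y} \<in> H" using C(3) W(1) by blast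
      ultimately have "common (Suc k) H u W" unfolding common_def using C(1,2)
        by (intro exI[of _ "insert c C"]) simp
      then show ?thesis ..
    qed
    with W Z show ?thesis by blast
  qed
qed

text \<open>The vertices of \<open>U\<close> are treated one after another. Each costs
  \<open>d\<close> square roots, whence the exponent, and both alternatives survive later
  thinning.\<close>

lemma rich_or_common:
  assumes "finite U" "triple_system H" "\<forall>u\<in>U. \<forall>y\<in>Y. d \<le> card (colink H u y)" "finite Y"
    "s ^ (2 ^ (d * card U)) \<le> card Y"
  shows "\<exists>Z\<subseteq>Y. card Z = s \<and> (\<forall>u\<in>U. rich H u Z \<or> common d H u Z)"
  using assms
proof (induction U arbitrary: Y rule: finite_induct)
  case empty
  then have "s \<le> card Y" by simp
  then obtain Z where "Z \<subseteq> Y" "card Z = s" by (rule obtain_subset_with_card_n)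
  then show ?case by blast
next
  case (insert u U)
  let ?s = "s ^ (2 ^ (d * card U))"
  have "?s ^ (2 ^ d) = s ^ (2 ^ (d * card U) * 2 ^ d)"
    by (rule power_mult[symmetric])
  also have "2 ^ (d * card U) * 2 ^ d = (2::nat) ^ (d * card U + d)"
    by (rule power_add[symmetric])
  also have "d * card U + d = d * card (insert u U)"
    by (simp only: card_insert_disjoint[OF insert.hyps(1,2)] mult_Suc_right add.commute)
  finally have "?s ^ (2 ^ d) \<le> card Y" using insert.prems(4) by (simp only:)
  from rich_or_common_step[OF insert.prems(1) _ insert.prems(3) order_refl this, of u]
    insert.prems(2)
  obtain Z where Z: "Z \<subseteq> Y" "card Z = ?s" "rich H u Z \<or> common d H u Z"
    by blast
  have "finite Z" using finite_subset[OF Z(1) insert.prems(3)] .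
  have "\<forall>u\<in>U. \<forall>y\<in>Z. d \<le> card (colink H u y)" using Z(1) insert.prems(2) by blast
  from insert.IH[OF insert.prems(1) this \<open>finite Z\<close> eq_refl[OF Z(2)[symmetric]]] obtain W
    where W: "W \<subseteq> Z" "card W = s" "\<forall>u\<in>U. rich H u W \<or> common d H u W"
    by blast
  with Z(3) have "rich H u W \<or> common d H u W"
    using rich_mono[of H u Z W] common_mono[of d H u Z W] by blast
  moreover have "W \<subseteq> Y" using W(1) Z(1) by blast
  ultimately show ?case using W(2,3) by blast
qed

text \<open>Tree vertices alternate between \<open>X\<close> and \<open>Y\<close>, and the apex that
  comes with a new vertex \<open>b\<close> is \<open>t b\<close>. A used set \<open>U\<close> blocks
  only the points of \<open>U\<close> and, by injectivity, at most \<open>card U\<close> points with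
  \<open>t b \<in> U\<close>.\<close>

lemma rich_rich_embeds:
  fixes H :: "'a set set"
  assumes "triple_system H" "rooted r V E" "\<forall>x\<in>X. rich H x Y" "\<forall>y\<in>Y. rich H y X"
    "4 * card V \<le> card X" "4 * card V \<le> card Y"
  shows "\<exists>h. embeds V E H h"
proof -
  have V: "card V > 0" using rooted_graph[OF assms(2)] by (auto simp: card_gt_0_iff)
  have step: "\<exists>b c. b \<notin> U \<and> c \<notin> U \<and> b \<noteq> c \<and> b \<in> B \<and> {a, b, c} \<in> H"
    if r: "rich H a B" and U: "finite U" "card U < 2 * card V" and B: "4 * card V \<le> card B"
    for a B U
  proof -
    obtain t where t: "inj_on t B" "\<forall>y\<in>B. {a, y, t y} \<in> H" using r by (auto simp: rich_def)
    let ?W = "U \<union> (t -` U \<inter> B)"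
    have "finite (t -` U \<inter> B)" using finite_vimage_IntI[OF U(1) t(1)] .
    moreover have "card (t -` U \<inter> B) \<le> card U"
      using card_vimage_inj_on_le[OF t(1) U(1)] .
    ultimately have "card ?W < card B" "finite ?W"
      using card_Un_le[of U "t -` U \<inter> B"] U B by auto
    then obtain b where b: "b \<in> B" "b \<notin> ?W" using ex_fresh by blast
    with t(2) have "{a, b, t b} \<in> H" by blast
    moreover from this have "b \<noteq> t b" by (rule triple_distinct(3)[OF assms(1)])
    moreover have "t b \<notin> U" using b by blast
    ultimately show ?thesis using b by blast
  qed
  have "X \<noteq> {}" using V assms(5) by auto
  then obtain a where a: "a \<in> X" by blast
  show ?thesis
  proof (rule embeds_greedy[OF assms(2), of "\<lambda>\<kappa> a. a \<in> (if \<kappa> then X else Y)" True a])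
    fix \<kappa> a and U :: "'a set"
    assume "a \<in> (if \<kappa> then X else Y)" "finite U" "card U < 2 * card V"
    then show "\<exists>b c. b \<notin> U \<and> c \<notin> U \<and> b \<noteq> c \<and> b \<in> (if \<not> \<kappa> then X else Y) \<and> {a, b, c} \<in> H"
      using step[of a Y U] step[of a X U] assms(3-6) by (cases \<kappa>) auto
  qed (use a in simp)
qed

text \<open>First \<open>Y\<close> is thinned with respect to vertices of \<open>X\<close>, then the
  rich vertices of \<open>X\<close> are thinned with respect to those of \<open>Y\<close>. If many
  vertices on both sides are rich, \<open>rich_rich_embeds\<close> applies; otherwise one side
  supplies enough \<open>common\<close> vertices, so \<open>X'\<close> may come from either
  side.\<close>

lemma common_grid:
  assumes tr: "rooted r V E"
  shows "\<exists>S. \<forall>(H :: 'b set set) X Y. triple_system H \<longrightarrow> full d H \<longrightarrow> finite X \<longrightarrow> finite Y \<longrightarrow>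
      S \<le> card X \<longrightarrow> S \<le> card Y \<longrightarrow> (\<forall>x\<in>X. \<forall>y\<in>Y. colink H x y \<noteq> {}) \<longrightarrow>
      (\<exists>h. embeds V E H h) \<or>
      (\<exists>X' Y'. finite X' \<and> finite Y' \<and> card X' = s \<and> card Y' = s \<and> (\<forall>x\<in>X'. common d H x Y'))"
proof -
  \<comment> \<open>The sizes are chosen backwards: \<open>N\<close> serves for the rich embedding
    as well as for \<open>s\<close> remaining vertices, \<open>m\<close> points can be thinned to
    \<open>N\<close> against \<open>2 * N\<close> vertices, and \<open>S\<close> leaves room for
    thinning \<open>Y\<close> against \<open>2 * m\<close> vertices. The factors 2 make one of two
    alternatives large.\<close>
  define N where "N = 4 * card V + s"
  define m where "m = N ^ (2 ^ (d * (2 * N)))"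
  define S where "S = 2 * m + (2 * N) ^ (2 ^ (d * (2 * m)))"
  have V: "card V > 0" using rooted_graph[OF tr] by (auto simp: card_gt_0_iff)
  then have N: "N > 0" "s \<le> N" by (auto simp: N_def)
  then have "N ^ 1 \<le> m" unfolding m_def by (intro power_increasing) auto
  then have m: "N \<le> m" by simp
  show ?thesis
  proof (intro exI[of _ S] allI impI)
    fix H :: "'b set set" and X Y
    assume H: "triple_system H" "full d H" and fin: "finite X" "finite Y"
      and S: "S \<le> card X" "S \<le> card Y" and co: "\<forall>x\<in>X. \<forall>y\<in>Y. colink H x y \<noteq> {}"
    have deg: "d \<le> card (colink H x y)" "d \<le> card (colink H y x)" if "x \<in> X" "y \<in> Y" for x y
    proof -
      show "d \<le> card (colink H x y)" using co H(2) that by (simp add: full_def)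
      then show "d \<le> card (colink H y x)" by (simp only: colink_commute[of H y x])
    qed
    have "2 * m \<le> card X" using S(1) unfolding S_def by linarith
    then obtain X1 where X1: "X1 \<subseteq> X" "card X1 = 2 * m" "finite X1"
      by (rule obtain_subset_with_card_n)
    have "\<exists>Z\<subseteq>Y. card Z = 2 * N \<and> (\<forall>u\<in>X1. rich H u Z \<or> common d H u Z)"
    proof (rule rich_or_common[OF X1(3) H(1) _ fin(2)])
      show "\<forall>u\<in>X1. \<forall>y\<in>Y. d \<le> card (colink H u y)" using deg(1) X1(1) by blast
      show "(2 * N) ^ (2 ^ (d * card X1)) \<le> card Y"
        using S(2) unfolding S_def X1(2) by linarith
    qed
    then obtain Y1 where Y1: "Y1 \<subseteq> Y" "card Y1 = 2 * N"
      "\<forall>u\<in>X1. rich H u Y1 \<or> common d H u Y1" by blast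
    have fY1: "finite Y1" using Y1(1) fin(2) by (rule finite_subset)
    define R where "R = {x \<in> X1. rich H x Y1}"
    have R: "R \<subseteq> X1" by (auto simp: R_def)
    show "(\<exists>h. embeds V E H h) \<or>
      (\<exists>X' Y'. finite X' \<and> finite Y' \<and> card X' = s \<and> card Y' = s \<and> (\<forall>x\<in>X'. common d H x Y'))"
    proof (cases "m \<le> card R")
      case False
      have "card (X1 - R) = 2 * m - card R"
        using card_Diff_subset[OF finite_subset[OF R X1(3)] R] X1(2) by simp
      then have "s \<le> card (X1 - R)" using False N m by linarith
      then obtain X' where X': "X' \<subseteq> X1 - R" "card X' = s" "finite X'"
        by (rule obtain_subset_with_card_n)
      have "s \<le> card Y1" using Y1 N by linarith
      then obtain Y' where Y': "Y' \<subseteq> Y1" "card Y' = s" "finite Y'"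
        by (rule obtain_subset_with_card_n)
      have "\<forall>x\<in>X'. common d H x Y1" using X'(1) Y1(3) by (auto simp: R_def)
      then have "\<forall>x\<in>X'. common d H x Y'" using common_mono[OF _ Y'(1)] by simp
      with X' Y' show ?thesis by blast
    next
      case True
      then obtain X2 where X2: "X2 \<subseteq> R" "card X2 = m" "finite X2"
        by (rule obtain_subset_with_card_n)
      have X2X: "X2 \<subseteq> X" using X2(1) R X1(1) by blast
      have "\<exists>Z\<subseteq>X2. card Z = N \<and> (\<forall>u\<in>Y1. rich H u Z \<or> common d H u Z)"
      proof (rule rich_or_common[OF fY1 H(1) _ X2(3)])
        show "\<forall>u\<in>Y1. \<forall>y\<in>X2. d \<le> card (colink H u y)" using deg(2) X2X Y1(1) by blast
        show "N ^ (2 ^ (d * card Y1)) \<le> card X2"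
          unfolding X2(2) Y1(2) m_def by (rule order_refl)
      qed
      then obtain X3 where X3: "X3 \<subseteq> X2" "card X3 = N"
        "\<forall>u\<in>Y1. rich H u X3 \<or> common d H u X3" by blast
      have fX3: "finite X3" using X3(1) X2(3) by (rule finite_subset)
      define T where "T = {y \<in> Y1. rich H y X3}"
      have T: "T \<subseteq> Y1" by (auto simp: T_def)
      show ?thesis
      proof (cases "N \<le> card T")
        case True
        have "\<forall>x\<in>X3. rich H x Y1" using X3(1) X2(1) by (auto simp: R_def)
        then have "\<forall>x\<in>X3. rich H x T" using rich_mono[OF _ T] by simp
        moreover have "\<forall>y\<in>T. rich H y X3" by (simp add: T_def)
        ultimately have "\<exists>h. embeds V E H h"
          using True X3(2) N_def
          by (intro rich_rich_embeds[OF H(1) tr, of X3 T]) linarith+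
        then show ?thesis ..
      next
        case False
        have "card (Y1 - T) = 2 * N - card T"
          using card_Diff_subset[OF finite_subset[OF T fY1] T] Y1(2) by simp
        then have "s \<le> card (Y1 - T)" using False N by linarith
        then obtain X' where X': "X' \<subseteq> Y1 - T" "card X' = s" "finite X'"
          by (rule obtain_subset_with_card_n)
        have "s \<le> card X3" using X3 N by linarith
        then obtain Y' where Y': "Y' \<subseteq> X3" "card Y' = s" "finite Y'"
          by (rule obtain_subset_with_card_n)
        have "\<forall>x\<in>X'. common d H x X3" using X'(1) X3(3) by (auto simp: T_def)
        then have "\<forall>x\<in>X'. common d H x Y'" using common_mono[OF _ Y'(1)] by simp
        with X' Y' show ?thesis by blast
      qed
    qed
  qed
qed

section \<open>Families of functions on one side of the grid\<close>

lemma thin_functions: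
  assumes "finite Q" "finite X" "s ^ (2 ^ card Q) \<le> card X"
  shows "\<exists>Z\<subseteq>X. card Z = s \<and> (\<forall>\<phi>\<in>Q. inj_on \<phi> Z \<or> (\<exists>c. \<forall>x\<in>Z. \<phi> x = c))"
  using assms
proof (induction Q arbitrary: s rule: finite_induct)
  case empty
  then have "s \<le> card X" by simp
  then obtain Z where "Z \<subseteq> X" "card Z = s" by (rule obtain_subset_with_card_n)
  then show ?case by blast
next
  case (insert \<phi> Q)
  have "(s * s) ^ (2 ^ card Q) \<le> card X"
    using insert.prems(2) insert.hyps by (simp add: power_mult power2_eq_square)
  from insert.IH[OF insert.prems(1) this] obtain Z where Z: "Z \<subseteq> X" "card Z = s * s"
    "\<forall>\<psi>\<in>Q. inj_on \<psi> Z \<or> (\<exists>c. \<forall>x\<in>Z. \<psi> x = c)" by blast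
  have "finite Z" using Z(1) insert.prems(1) by (rule finite_subset)
  from const_or_inj[OF this eq_refl[OF Z(2)[symmetric]], of \<phi>] obtain W where
    W: "W \<subseteq> Z" "card W = s" "inj_on \<phi> W \<or> (\<exists>c. \<forall>x\<in>W. \<phi> x = c)" by blast
  have "inj_on \<psi> W \<or> (\<exists>c. \<forall>x\<in>W. \<psi> x = c)" if "\<psi> \<in> Q" for \<psi>
    using Z(3) that W(1) inj_on_subset[of \<psi> Z W] by blast
  then have "\<forall>\<psi>\<in>insert \<phi> Q. inj_on \<psi> W \<or> (\<exists>c. \<forall>x\<in>W. \<psi> x = c)" using W(3) by blast
  moreover have "W \<subseteq> X" using W(1) Z(1) by blast
  ultimately show ?case using W(2) by blast
qed

text \<open>Greedy choice: as every \<open>\<psi>\<close> is injective, a chosen \<open>x\<close>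
  excludes itself and, for each pair of functions, at most one \<open>y\<close> with
  \<open>\<psi> y = \<phi> x\<close>. Afterwards the sets of values belonging to different points of
  \<open>Z\<close> are disjoint.\<close>

lemma separate_functions:
  assumes "finite X" "finite \<Phi>" "\<forall>\<phi>\<in>\<Phi>. inj_on \<phi> X" "s * (card \<Phi> * card \<Phi> + 1) \<le> card X"
  shows "\<exists>Z\<subseteq>X. card Z = s \<and> (\<forall>\<phi>\<in>\<Phi>. \<forall>\<psi>\<in>\<Phi>. \<forall>x\<in>Z. \<forall>y\<in>Z. x \<noteq> y \<longrightarrow> \<phi> x \<noteq> \<psi> y)"
  using assms(1,3,4)
proof (induction s arbitrary: X)
  case 0
  then show ?case by (intro exI[of _ "{}"]) simp
next
  case (Suc s)
  from Suc.prems have "X \<noteq> {}" by auto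
  then obtain x where x: "x \<in> X" by blast
  define B where "B = (\<Union>(\<phi>, \<psi>)\<in>\<Phi> \<times> \<Phi>. {y \<in> X. \<psi> y = \<phi> x})"
  have one: "card {y \<in> X. \<psi> y = c} \<le> 1" if "\<psi> \<in> \<Phi>" for \<psi> c
  proof -
    have "inj_on \<psi> X" using Suc.prems(2) that by blast
    then show ?thesis
      using Suc.prems(1) by (auto simp: card_le_Suc0_iff_eq inj_on_def)
  qed
  have "card B \<le> (\<Sum>p\<in>\<Phi> \<times> \<Phi>. 1)"
    unfolding B_def using one assms(2)
    by (intro order_trans[OF card_UN_le] sum_mono) auto
  then have cB: "card B \<le> card \<Phi> * card \<Phi>" using assms(2) by (simp add: card_cartesian_product)
  have fB: "finite B" unfolding B_def using Suc.prems assms(2) by auto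
  let ?X = "X - insert x B"
  have "card X - card (insert x B) \<le> card ?X"
    using fB by (intro diff_card_le_card_Diff) simp
  moreover have "card (insert x B) \<le> card \<Phi> * card \<Phi> + 1"
    using cB card_insert_if[OF fB, of x] by simp
  moreover have "s * (card \<Phi> * card \<Phi> + 1) + (card \<Phi> * card \<Phi> + 1) \<le> card X"
    using Suc.prems(3) by simp
  ultimately have "s * (card \<Phi> * card \<Phi> + 1) \<le> card ?X" by linarith
  moreover have "\<forall>\<phi>\<in>\<Phi>. inj_on \<phi> ?X" using Suc.prems(2) inj_on_subset by blast
  ultimately obtain Z where Z: "Z \<subseteq> ?X" "card Z = s"
    "\<forall>\<phi>\<in>\<Phi>. \<forall>\<psi>\<in>\<Phi>. \<forall>x\<in>Z. \<forall>y\<in>Z. x \<noteq> y \<longrightarrow> \<phi> x \<noteq> \<psi> y"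
    using Suc.IH[of ?X] Suc.prems(1) by blast
  have new: "\<phi> x \<noteq> \<psi> y" if "\<phi> \<in> \<Phi>" "\<psi> \<in> \<Phi>" "y \<in> Z" for \<phi> \<psi> y
  proof
    assume "\<phi> x = \<psi> y"
    moreover have "y \<in> X" "y \<notin> B" using that(3) Z(1) by blast+
    ultimately have "y \<in> B" unfolding B_def using that(1,2)
      by (intro UN_I[of "(\<phi>, \<psi>)"]) auto
    with \<open>y \<notin> B\<close> show False ..
  qed
  have "finite Z" using Z(1) Suc.prems(1) finite_subset by blast
  moreover have "x \<notin> Z" using Z(1) by blast
  ultimately have "card (insert x Z) = Suc s" using Z(2) by simp
  moreover have "insert x Z \<subseteq> X" using Z(1) x by blast
  moreover have "\<phi> y \<noteq> \<psi> z" if "\<phi> \<in> \<Phi>" "\<psi> \<in> \<Phi>" "y \<in> insert x Z" "z \<in> insert x Z" "y \<noteq> z" for \<phi> \<psi> y z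
    using that new[of \<phi> \<psi> z] new[of \<psi> \<phi> y] Z(3) by fastforce
  ultimately show ?case by blast
qed

section \<open>Embedding into canonical configurations\<close>

text \<open>For \<open>I \<subseteq> V\<close> this is the quantity minimised in
  \<open>crosscut\<close>. Intersecting with \<open>V\<close> lets \<open>I\<close> stay fixed while
  the tree is built up.\<close>

definition weight :: "'a set \<Rightarrow> 'a set \<Rightarrow> 'a set set \<Rightarrow> nat" where
  "weight I V E = card (V \<inter> I) + card {e \<in> E. e \<inter> I = {}}"

text \<open>If \<open>u \<in> I\<close>, then \<open>v\<close> is outside \<open>I\<close> and the
  new edge meets \<open>I\<close>. Otherwise exactly one of the vertex \<open>v\<close> and the edge
  \<open>{u, v}\<close> is counted anew.\<close>

lemma weight_leaf:
  assumes "finite V" "finite E" "graph V E" "v \<notin> V" "\<not> {u, v} \<subseteq> I"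
  shows "weight I (insert v V) (insert {u, v} E)
    = weight I V E + (if u \<in> I then 0 else 1)"
proof -
  have "{u, v} \<notin> E" using assms by (auto simp: graph_def)
  moreover have "{e \<in> insert {u, v} E. e \<inter> I = {}}
    = (if u \<in> I \<or> v \<in> I then {e \<in> E. e \<inter> I = {}} else insert {u, v} {e \<in> E. e \<inter> I = {}})"
    by auto
  moreover have "insert v V \<inter> I = (if v \<in> I then insert v (V \<inter> I) else V \<inter> I)" by auto
  ultimately show ?thesis using assms by (auto simp: weight_def)
qed

lemma card_embeds_image:
  assumes "rooted r V E"
  shows "finite (h ` tri_blowup_V V E)" "card (h ` tri_blowup_V V E) < 2 * card V"
proof -
  note g = rooted_graph[OF assms]
  have f: "finite (tri_blowup_V V E)" using g(2,3) by (simp add: tri_blowup_V_def)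
  then show "finite (h ` tri_blowup_V V E)" by simp
  have "card (h ` tri_blowup_V V E) \<le> card V + card E"
    using card_image_le[OF f, of h] card_tri_blowup_V[OF g(2,3)] by simp
  then show "card (h ` tri_blowup_V V E) < 2 * card V" using g(5) by linarith
qed

lemma image_leaf:
  assumes "\<And>w. w \<in> V \<Longrightarrow> h' (Inl w) = h (Inl w)" "\<And>e. e \<in> E \<Longrightarrow> h' (Inr e) = h (Inr e)"
  shows "h' ` tri_blowup_V (insert v V) (insert e E)
    = insert (h' (Inl v)) (insert (h' (Inr e)) (h ` tri_blowup_V V E))"
  using assms by (auto simp: tri_blowup_V_def image_Un image_image)

lemma card_insert_Int:
  assumes "finite P"
  shows "card (insert b P \<inter> A) \<le> card (P \<inter> A) + 1" "b \<notin> A \<Longrightarrow> card (insert b P \<inter> A) = card (P \<inter> A)"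
  using assms by (auto simp: Int_insert_left card_insert_if)

text \<open>Configuration (2) of the overview. Vertices in \<open>I\<close> and apexes of edges
  missing \<open>I\<close> are sent to \<open>C\<close>, everything else to \<open>X\<close> and
  \<open>Y\<close>. By \<open>weight_leaf\<close>, a leaf uses up a vertex of \<open>C\<close> only
  when it raises the weight, so \<open>C\<close> does not run out.\<close>

lemma tripartite_embeds:
  fixes H :: "'b set set"
  assumes H: "triple_system H" and tr: "rooted r V E" and ind: "\<forall>e\<in>E. \<not> e \<subseteq> I"
    and C: "finite C" "weight I V E \<le> card C"
    and big: "2 * card V \<le> card X" "2 * card V \<le> card Y"
    and all: "\<forall>x\<in>X. \<forall>c\<in>C. \<forall>y\<in>Y. {x, c, y} \<in> H"
  shows "\<exists>h. embeds V E H h"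
proof -
  have V: "card V > 0" using rooted_graph[OF tr] by (auto simp: card_gt_0_iff)
  then have "X \<noteq> {}" "Y \<noteq> {}" using big by auto
  then obtain x0 y0 where xy: "x0 \<in> X" "y0 \<in> Y" by blast
  \<comment> \<open>A vertex of \<open>C\<close> in \<open>X\<close> or \<open>Y\<close> would give
    a triple with a repeated vertex.\<close>
  have disj: "x \<notin> C" "y \<notin> C" if "x \<in> X" "y \<in> Y" for x y
  proof -
    show "x \<notin> C" using all that triple_distinct(1)[OF H, of x x y] by blast
    show "y \<notin> C" using all that triple_distinct(3)[OF H, of x y y] by blast
  qed
  let ?good = "\<lambda>V' h. \<forall>p\<in>V'. if p \<in> I then h (Inl p) \<in> C else h (Inl p) \<in> X \<union> Y"
  have "\<exists>h. embeds V' E' H h \<and> ?good V' h \<and> card (h ` tri_blowup_V V' E' \<inter> C) \<le> weight I V' E'"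
    if "rooted r V' E'" "card V' \<le> card V" "\<forall>e\<in>E'. \<not> e \<subseteq> I" "weight I V' E' \<le> card C" for V' E'
    using that
  proof induction
    case root
    show ?case
    proof (cases "r \<in> I")
      case True
      then have "card C > 0" using root by (simp add: weight_def)
      then obtain c where c: "c \<in> C" using C(1) by (auto simp: card_gt_0_iff)
      then show ?thesis using True
        by (intro exI[of _ "\<lambda>_. c"]) (auto simp: embeds_def tri_blowup_V_def weight_def)
    next
      case False
      then show ?thesis using xy disj
        by (intro exI[of _ "\<lambda>_. x0"]) (auto simp: embeds_def tri_blowup_V_def weight_def)
    qed
  next
    case (leaf V' E' u v)
    note g = rooted_graph[OF leaf.hyps(1)]
    have ni: "\<not> {u, v} \<subseteq> I" using leaf.prems(2) by blast
    note w = weight_leaf[OF g(2,3,4) leaf.hyps(3) ni]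
    have "card V' \<le> card V" using leaf.prems(1) g(2) leaf.hyps(3) by simp
    moreover have "weight I V' E' \<le> card C" using leaf.prems(3) w by simp
    ultimately obtain h where h: "embeds V' E' H h" "?good V' h"
      and cC: "card (h ` tri_blowup_V V' E' \<inter> C) \<le> weight I V' E'"
      using leaf.IH leaf.prems(2) by auto
    let ?P = "h ` tri_blowup_V V' E'"
    note P = card_embeds_image[OF leaf.hyps(1), of h]
    have lt: "card ?P < card X" "card ?P < card Y"
      using P(2) big \<open>card V' \<le> card V\<close> by linarith+
    obtain x where x: "x \<in> X" "x \<notin> ?P" using ex_fresh[OF P(1) lt(1)] by blast
    obtain y where y: "y \<in> Y" "y \<notin> ?P" using ex_fresh[OF P(1) lt(2)] by blast
    \<comment> \<open>The common end of all cases: \<open>v\<close> is sent to \<open>b\<close> and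
      the apex over the new edge to \<open>c\<close>.\<close>
    have place: ?case
      if b: "b \<notin> ?P" "c \<notin> ?P" "{h (Inl u), b, c} \<in> H"
        and v: "if v \<in> I then b \<in> C else b \<in> X \<union> Y"
        and count: "card (insert b (insert c ?P) \<inter> C)
          \<le> weight I (insert v V') (insert {u, v} E')"
      for b c
    proof -
      have "b \<noteq> c" using triple_distinct(3)[OF H b(3)] .
      from embeds_leaf[OF h(1) g(4) leaf.hyps(2,3) b(1,2) this b(3)] obtain h' where h':
        "embeds (insert v V') (insert {u, v} E') H h'"
        "\<And>w. w \<in> V' \<Longrightarrow> h' (Inl w) = h (Inl w)" "\<And>e. e \<in> E' \<Longrightarrow> h' (Inr e) = h (Inr e)"
        "h' (Inl v) = b" "h' (Inr {u, v}) = c" by blast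
      have "?good (insert v V') h'"
      proof
        fix p assume "p \<in> insert v V'"
        then show "if p \<in> I then h' (Inl p) \<in> C else h' (Inl p) \<in> X \<union> Y"
          using h(2)[rule_format, of p] h'(2)[of p] h'(4) v
          by (cases "p = v") (auto split: if_splits)
      qed
      moreover have "h' ` tri_blowup_V (insert v V') (insert {u, v} E') = insert b (insert c ?P)"
        using image_leaf[of V' h' h E' v "{u, v}"] h'(2-5) by simp
      ultimately show ?thesis using h'(1) count by metis
    qed
    show ?case
    proof (cases "u \<in> I")
      case True
      then have "h (Inl u) \<in> C" using h(2) leaf.hyps(2) by simp
      then have "{x, h (Inl u), y} \<in> H" using all x(1) y(1) by blast
      then have "{h (Inl u), x, y} \<in> H" by (simp add: insert_commute)
      then show ?thesis
        using x y disj[OF x(1) y(1)] True ni cC w P(1)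
        by (intro place[of x y]) (auto simp: card_insert_Int(2))
    next
      case False
      have "card (?P \<inter> C) < card C" using cC leaf.prems(3) w False by simp
      then obtain c where c: "c \<in> C" "c \<notin> ?P" using ex_fresh[of "?P \<inter> C" C] P(1) by blast
      have "h (Inl u) \<in> X \<union> Y"
        using h(2)[rule_format, OF leaf.hyps(2)] False by (simp split: if_splits)
      \<comment> \<open>\<open>z\<close> is taken on the side opposite to
        \<open>h (Inl u)\<close>.\<close>
      then obtain z where z: "z \<in> X \<union> Y" "z \<notin> ?P" "z \<notin> C" "{h (Inl u), z, c} \<in> H"
      proof
        assume "h (Inl u) \<in> X"
        then have "{h (Inl u), c, y} \<in> H" using all c(1) y(1) by blast
        then show ?thesis using that[of y] y disj[OF x(1) y(1)] by (simp add: insert_commute)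
      next
        assume "h (Inl u) \<in> Y"
        then have "{x, c, h (Inl u)} \<in> H" using all c(1) x(1) by blast
        then show ?thesis using that[of x] x disj[OF x(1) y(1)] by (simp add: insert_commute)
      qed
      have "card (insert c ?P \<inter> C) \<le> card (?P \<inter> C) + 1" using card_insert_Int(1)[OF P(1)] .
      then have n1: "card (insert z (insert c ?P) \<inter> C) \<le> weight I (insert v V') (insert {u, v} E')"
        using card_insert_Int(2)[of "insert c ?P" z C] P(1) z(3) cC w False by simp
      show ?thesis
      proof (cases "v \<in> I")
        case True
        then show ?thesis using place[of c z] c z n1 by (simp add: insert_commute)
      next
        case False
        then show ?thesis using place[of z c] c z n1 by simp
      qed
    qed
  qed
  from this[OF tr order_refl ind C(2)] show ?thesis by blast
qed

text \<open>
  A layer \<open>F i\<close> consists of functions on \<open>X\<close>, to be read as families of vertices \<open>\<phi> x\<close> at distance at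
  most \<open>i\<close> from \<open>x\<close> in the common link of \<open>Y\<close>. After thinning \<open>X\<close>, the \<open>d\<close> link neighbours of \<open>\<phi> x\<close>
  again form functions of \<open>x\<close> that are injective (next layer) or constant (a hub, collected in \<open>K\<close>);
  hubs need not be explored, because \<open>\<phi> x\<close> is a neighbour of the hub for all \<open>x \<in> X\<close>.
\<close>

definition children ::
  "nat \<Rightarrow> 'b set set \<Rightarrow> 'b set \<Rightarrow> 'b set \<Rightarrow> ('b \<Rightarrow> 'b) \<Rightarrow> ('b \<Rightarrow> 'b) set \<Rightarrow> 'b set \<Rightarrow> bool" where
  "children d H X Y \<phi> G K \<longleftrightarrow> (\<exists>\<psi>. (\<forall>x\<in>X. inj_on (\<lambda>l. \<psi> l x) {..<d}) \<and>
     (\<forall>l<d. \<forall>x\<in>X. \<forall>y\<in>Y. {\<phi> x, \<psi> l x, y} \<in> H) \<and>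
     (\<forall>l<d. \<psi> l \<in> G \<or> (\<exists>c\<in>K. \<forall>x\<in>X. \<psi> l x = c)))"

definition layered ::
  "nat \<Rightarrow> 'b set set \<Rightarrow> nat \<Rightarrow> 'b set \<Rightarrow> 'b set \<Rightarrow> (nat \<Rightarrow> ('b \<Rightarrow> 'b) set) \<Rightarrow> 'b set \<Rightarrow> bool" where
  "layered d H n X Y F K \<longleftrightarrow>
     F 0 = {id} \<and> finite K \<and> card K \<le> n * d ^ n \<and> K \<inter> Y = {} \<and>
     (\<forall>i\<le>n. finite (F i) \<and> card (F i) \<le> d ^ i \<and> (\<forall>\<phi>\<in>F i. inj_on \<phi> X)) \<and>
     (\<forall>i<n. \<forall>\<phi>\<in>F i. children d H X Y \<phi> (F (Suc i)) K) \<and>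
     (\<forall>i<n. \<forall>\<phi>\<in>F (Suc i). \<exists>\<mu>\<in>F i. \<forall>x\<in>X. \<forall>y\<in>Y. {\<phi> x, \<mu> x, y} \<in> H)"

text \<open>Configuration (3) of the overview. At weight \<open>m\<close> only layers up to
  \<open>m\<close> have been reached, which is recorded by \<open>good m\<close>; going one layer
  deeper costs one unit of weight, so layers up to \<open>d\<close> suffice. By \<open>sep\<close>
  and \<open>hub\<close>, vertices with different owners never interfere.\<close>

lemma layered_embeds:
  fixes H :: "'b set set"
  assumes H: "triple_system H" and tr: "rooted r V E" and ind: "\<forall>e\<in>E. \<not> e \<subseteq> I"
    and I: "r \<in> I" "weight I V E \<le> d" and d: "1 \<le> d"
    and lay: "layered d H d X Y F K" "F 1 \<noteq> {}"
    and sep: "\<And>i j \<phi> \<psi> x y. i \<le> d \<Longrightarrow> j \<le> d \<Longrightarrow> \<phi> \<in> F i \<Longrightarrow> \<psi> \<in> F j \<Longrightarrow> x \<in> X \<Longrightarrow> y \<in> X \<Longrightarrow>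
      x \<noteq> y \<Longrightarrow> \<phi> x \<noteq> \<psi> y"
    and hub: "\<And>i \<phi> x. i \<le> d \<Longrightarrow> \<phi> \<in> F i \<Longrightarrow> x \<in> X \<Longrightarrow> \<phi> x \<notin> K"
    and big: "2 * card V \<le> card X" "2 * card V \<le> card Y"
  shows "\<exists>h. embeds V E H h"
proof -
  have F0: "F 0 = {id}" and K: "finite K" "K \<inter> Y = {}" using lay(1) by (auto simp: layered_def)
  have fF: "finite (F i)" if "i \<le> d" for i using lay(1) that by (auto simp: layered_def)
  have ch: "children d H X Y \<phi> (F (Suc i)) K" if "i < d" "\<phi> \<in> F i" for i \<phi>
    using lay(1) that by (simp add: layered_def)
  have mate: "\<exists>\<mu>\<in>F i. \<forall>x\<in>X. \<forall>y\<in>Y. {\<phi> x, \<mu> x, y} \<in> H" if "i < d" "\<phi> \<in> F (Suc i)" for i \<phi>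
    using lay(1) that by (simp add: layered_def)
  from lay(2) obtain \<phi>1 where p1: "\<phi>1 \<in> F 1" by blast
  have V: "card V > 0" using rooted_graph[OF tr] by (auto simp: card_gt_0_iff)
  then have "X \<noteq> {}" "Y \<noteq> {}" using big by auto
  then obtain y0 where y0: "y0 \<in> Y" by blast
  \<comment> \<open>\<open>Own x\<close> collects all that the layers attach to \<open>x\<close>.
    These sets turn out to be pairwise disjoint and to avoid \<open>Y\<close> and the hubs.\<close>
  define Own where "Own x = (\<Union>i\<le>d. (\<lambda>\<phi>. \<phi> x) ` F i)" for x
  have Oy: "y \<notin> Own x" if "x \<in> X" "y \<in> Y" for x y
  proof
    assume "y \<in> Own x"
    then obtain i \<phi> where i: "i \<le> d" "\<phi> \<in> F i" "y = \<phi> x" by (auto simp: Own_def)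
    show False
    proof (cases i)
      case 0
      with i d have "children d H X Y \<phi> (F (Suc 0)) K" using ch by simp
      then obtain \<psi> where "\<forall>l<d. \<forall>x\<in>X. \<forall>y\<in>Y. {\<phi> x, \<psi> l x, y} \<in> H"
        by (auto simp: children_def)
      then have "{\<phi> x, \<psi> 0 x, y} \<in> H" using d that by simp
      then show False using triple_distinct(2)[OF H] i(3) by blast
    next
      case (Suc j)
      then obtain \<mu> where "\<forall>x\<in>X. \<forall>y\<in>Y. {\<phi> x, \<mu> x, y} \<in> H" using mate[of j \<phi>] i by auto
      then have "{\<phi> x, \<mu> x, y} \<in> H" using that by blast
      then show False using triple_distinct(2)[OF H] i(3) by blast
    qed
  qed
  have Osep: "Own x \<inter> Own y = {}" if "x \<in> X" "y \<in> X" "x \<noteq> y" for x y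
    using sep[OF _ _ _ _ that] by (auto simp: Own_def)
  have OK: "Own x \<inter> K = {}" if "x \<in> X" for x
    using hub[OF _ _ that] by (auto simp: Own_def)
  \<comment> \<open>If \<open>P\<close> met every \<open>Own x\<close>, disjointness would give
    distinct elements of \<open>P\<close> for distinct \<open>x\<close>, but \<open>P\<close> is
    smaller than \<open>X\<close>.\<close>
  have fresh: "\<exists>x\<in>X. Own x \<inter> P = {}" if P: "finite P" "card P < 2 * card V" for P
  proof (rule ccontr)
    assume "\<not> ?thesis"
    then have "\<forall>x\<in>X. \<exists>b. b \<in> Own x \<inter> P" by blast
    then obtain b where b: "\<forall>x\<in>X. b x \<in> Own x \<inter> P" by metis
    have "inj_on b X"
    proof (rule inj_onI)
      fix x y assume "x \<in> X" "y \<in> X" "b x = b y"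
      then have "b x \<in> Own x \<inter> Own y" using b by (metis IntD1 IntI)
      then show "x = y" using Osep[of x y] \<open>x \<in> X\<close> \<open>y \<in> X\<close> by blast
    qed
    moreover have "b ` X \<subseteq> P" using b by blast
    ultimately have "card X \<le> card P" using P(1) by (metis card_inj_on_le)
    with P(2) big(1) show False by linarith
  qed
  \<comment> \<open>For a hub a whole family \<open>\<phi>\<close> of neighbours is remembered, so
    that the way out of the hub can use any \<open>x \<in> X\<close>.\<close>
  define good where "good m b \<longleftrightarrow> (\<exists>i\<le>m. \<exists>\<phi>\<in>F i. \<exists>x\<in>X. b = \<phi> x) \<or>
    (b \<in> K \<and> (\<exists>i<m. \<exists>\<phi>\<in>F i. \<forall>x\<in>X. \<forall>y\<in>Y. {\<phi> x, b, y} \<in> H))" for m b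
  have good_mono: "good m b \<Longrightarrow> m \<le> m' \<Longrightarrow> good m' b" for m m' b
    unfolding good_def by (meson le_trans less_le_trans)
  have ext: "\<exists>c. c \<notin> P \<and> good (Suc m) c \<and> (\<forall>y\<in>Y. {b, c, y} \<in> H)"
    if b: "good m b" "m < d" "b \<in> P" and P: "finite P" "card P < 2 * card V"
      and count: "\<And>x. x \<in> X \<Longrightarrow> card (P \<inter> (K \<union> Own x)) \<le> m + 1" for m b P
    using b(1) unfolding good_def[of m]
  proof (elim disjE conjE exE bexE)
    fix i \<phi> x assume i: "i \<le> m" "\<phi> \<in> F i" "x \<in> X" "b = \<phi> x"
    have "children d H X Y \<phi> (F (Suc i)) K" using ch[of i \<phi>] i b(2) by simp
    then obtain \<psi> where inj: "inj_on (\<lambda>l. \<psi> l x) {..<d}"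
      and tri: "\<And>l y. l < d \<Longrightarrow> y \<in> Y \<Longrightarrow> {b, \<psi> l x, y} \<in> H"
      and all: "\<And>l z y. l < d \<Longrightarrow> z \<in> X \<Longrightarrow> y \<in> Y \<Longrightarrow> {\<phi> z, \<psi> l z, y} \<in> H"
      and cases: "\<And>l. l < d \<Longrightarrow> \<psi> l \<in> F (Suc i) \<or> (\<exists>c\<in>K. \<forall>x\<in>X. \<psi> l x = c)"
      using i(3,4) unfolding children_def by auto
    let ?S = "(\<lambda>l. \<psi> l x) ` {..<d}"
    have SK: "\<psi> l x \<in> K \<union> Own x" if "l < d" for l
      using cases[OF that]
    proof
      assume "\<psi> l \<in> F (Suc i)"
      moreover have "Suc i \<le> d" using i(1) b(2) by simp
      ultimately show ?thesis by (auto simp: Own_def)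
    next
      assume "\<exists>c\<in>K. \<forall>x\<in>X. \<psi> l x = c"
      then show ?thesis using i(3) by auto
    qed
    have bS: "b \<noteq> \<psi> l x" if "l < d" for l
      using triple_distinct(1)[OF H tri[OF that y0]] .
    have "i \<le> d" using i(1) b(2) by simp
    then have bO: "b \<in> P \<inter> (K \<union> Own x)" using i b(3) by (auto simp: Own_def)
    \<comment> \<open>Of the at most \<open>m + 1\<close> used vertices in
      \<open>K \<union> Own x\<close> one is \<open>b\<close>, which is not its own neighbour. So at
      most \<open>m < d\<close> of the \<open>d\<close> neighbours are blocked.\<close>
    have "P \<inter> ?S \<subseteq> P \<inter> (K \<union> Own x) - {b}" using SK bS by auto
    then have "card (P \<inter> ?S) \<le> card (P \<inter> (K \<union> Own x) - {b})"
      using P(1) by (intro card_mono) auto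
    also have "\<dots> = card (P \<inter> (K \<union> Own x)) - 1" using bO by (rule card_Diff_singleton)
    also have "\<dots> < d" using count[OF i(3)] b(2) by linarith
    also have "d = card ?S" using card_image[OF inj] by simp
    finally obtain c where c: "c \<in> ?S" "c \<notin> P" using ex_fresh[of "P \<inter> ?S" ?S] P(1) by auto
    then obtain l where l: "l < d" "c = \<psi> l x" by blast
    have "good (Suc m) c"
      using cases[OF l(1)]
    proof
      assume "\<psi> l \<in> F (Suc i)"
      then show ?thesis using i(1,3) l(2) unfolding good_def by (metis Suc_le_mono)
    next
      assume "\<exists>c\<in>K. \<forall>x\<in>X. \<psi> l x = c"
      then have "c \<in> K" and cc: "\<And>z. z \<in> X \<Longrightarrow> \<psi> l z = c" using i(3) l(2) by auto
      moreover have "\<forall>z\<in>X. \<forall>y\<in>Y. {\<phi> z, c, y} \<in> H" using all[OF l(1)] cc by metis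
      moreover have "i < Suc m" using i(1) by simp
      ultimately show ?thesis using i(2) unfolding good_def by blast
    qed
    moreover have "\<forall>y\<in>Y. {b, c, y} \<in> H" using tri[OF l(1)] l(2) by simp
    ultimately show ?thesis using c(2) by blast
  next
    \<comment> \<open>Here \<open>b\<close> is a hub: \<open>\<phi> x\<close> is a neighbour for
      every \<open>x\<close>, and some \<open>Own x\<close> is still untouched.\<close>
    fix i \<phi> assume i: "i < m" "\<phi> \<in> F i" "\<forall>x\<in>X. \<forall>y\<in>Y. {\<phi> x, b, y} \<in> H"
    obtain x where x: "x \<in> X" "Own x \<inter> P = {}" using fresh[OF P] by blast
    have "\<phi> x \<in> Own x" using i b(2) by (auto simp: Own_def)
    then have "\<phi> x \<notin> P" using x(2) by blast
    moreover have "good (Suc m) (\<phi> x)"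
    proof -
      have "i \<le> Suc m" using i(1) by simp
      with i(2) x(1) show ?thesis unfolding good_def by blast
    qed
    moreover have "\<forall>y\<in>Y. {b, \<phi> x, y} \<in> H" using i(3) x(1) by (simp add: insert_commute)
    ultimately show ?thesis by blast
  qed
  txt \<open>
    The images of tree vertices outside \<open>I\<close> are vertices of the link, the rest goes to \<open>Y\<close>. A new
    component of the forest starts at a fresh \<open>x\<close> with the edge from \<open>x\<close> to \<open>\<phi>1 x\<close>; every other step
    adds one link neighbour of a used vertex and raises the weight by one. Only hubs and vertices
    with the same owner \<open>x\<close> can block such a step, and the last two invariants bound their number.
  \<close>
  let ?good = "\<lambda>V' w h. \<forall>p\<in>V'. if p \<in> I then h (Inl p) \<in> Y else good w (h (Inl p))"
  have "\<exists>h. embeds V' E' H h \<and> ?good V' (weight I V' E') h \<and>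
      card (h ` tri_blowup_V V' E' \<inter> K) + 1 \<le> weight I V' E' \<and>
      (\<forall>x\<in>X. card (h ` tri_blowup_V V' E' \<inter> (K \<union> Own x)) \<le> weight I V' E' + 1)"
    if "rooted r V' E'" "card V' \<le> card V" "\<forall>e\<in>E'. \<not> e \<subseteq> I" "weight I V' E' \<le> d" for V' E'
    using that
  proof induction
    case root
    have "y0 \<notin> K" using y0 K(2) by blast
    with I(1) y0 Oy show ?case
      by (intro exI[of _ "\<lambda>_. y0"]) (auto simp: embeds_def tri_blowup_V_def weight_def)
  next
    case (leaf V' E' u v)
    note g = rooted_graph[OF leaf.hyps(1)]
    have ni: "\<not> {u, v} \<subseteq> I" using leaf.prems(2) by blast
    note w = weight_leaf[OF g(2,3,4) leaf.hyps(3) ni]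
    define m where "m = weight I V' E'"
    define m' where "m' = weight I (insert v V') (insert {u, v} E')"
    have m': "m' = m + (if u \<in> I then 0 else 1)" "m' \<le> d"
      using w leaf.prems(3) by (simp_all add: m_def m'_def)
    have cV: "card V' \<le> card V" using leaf.prems(1) g(2) leaf.hyps(3) by simp
    have "m \<le> d" using m' by simp
    with leaf.IH leaf.prems(2) cV obtain h where h: "embeds V' E' H h" "?good V' m h"
      and cK: "card (h ` tri_blowup_V V' E' \<inter> K) + 1 \<le> m"
      and cO: "\<And>x. x \<in> X \<Longrightarrow> card (h ` tri_blowup_V V' E' \<inter> (K \<union> Own x)) \<le> m + 1"
      by (auto simp: m_def)
    define P where "P = h ` tri_blowup_V V' E'"
    note cK = cK[folded P_def] and cO = cO[folded P_def]
    have P: "finite P" "card P < 2 * card V"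
      using card_embeds_image[OF leaf.hyps(1), of h] cV by (auto simp: P_def)
    have "card P < card Y" using P(2) big by linarith
    from ex_fresh[OF P(1) this] obtain y where y: "y \<in> Y" "y \<notin> P" by blast
    have uP: "h (Inl u) \<in> P" using leaf.hyps(2) by (auto simp: P_def tri_blowup_V_def)
    have place: ?case
      if b: "b \<notin> P" "c \<notin> P" "{h (Inl u), b, c} \<in> H"
        and v: "if v \<in> I then b \<in> Y else good m' b"
        and count: "card (insert b (insert c P) \<inter> K) + 1 \<le> m'"
          "\<And>x. x \<in> X \<Longrightarrow> card (insert b (insert c P) \<inter> (K \<union> Own x)) \<le> m' + 1"
      for b c
    proof -
      have "b \<noteq> c" using triple_distinct(3)[OF H b(3)] .
      from embeds_leaf[OF h(1) g(4) leaf.hyps(2,3) b(1,2)[unfolded P_def] this b(3)]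
      obtain h' where h':
        "embeds (insert v V') (insert {u, v} E') H h'"
        "\<And>w. w \<in> V' \<Longrightarrow> h' (Inl w) = h (Inl w)" "\<And>e. e \<in> E' \<Longrightarrow> h' (Inr e) = h (Inr e)"
        "h' (Inl v) = b" "h' (Inr {u, v}) = c" by blast
      have "m \<le> m'" using m' by simp
      have "?good (insert v V') m' h'"
      proof
        fix p assume p: "p \<in> insert v V'"
        show "if p \<in> I then h' (Inl p) \<in> Y else good m' (h' (Inl p))"
        proof (cases "p = v")
          case True then show ?thesis using h'(4) v by simp
        next
          case False
          then have "p \<in> V'" using p by simp
          then show ?thesis
            using h(2)[rule_format, of p] h'(2)[of p] good_mono[OF _ \<open>m \<le> m'\<close>]
            by (simp split: if_splits)
        qed
      qed
      moreover have "h' ` tri_blowup_V (insert v V') (insert {u, v} E') = insert b (insert c P)"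
        using image_leaf[of V' h' h E' v "{u, v}"] h'(2-5) by (simp add: P_def)
      ultimately show ?thesis using h'(1) count unfolding m'_def by (intro exI[of _ h']) simp
    qed
    show ?case
    proof (cases "u \<in> I")
      case True
      then have hu: "h (Inl u) \<in> Y" using h(2) leaf.hyps(2) by simp
      have vI: "v \<notin> I" using ni True by simp
      have mm: "m' = m" using m' True by simp
      obtain x where x: "x \<in> X" "Own x \<inter> P = {}" using fresh[OF P] by blast
      \<comment> \<open>Layer 0 is \<open>{id}\<close>, so \<open>\<mu> x = x\<close>, and
        \<open>x\<close> and \<open>\<phi>1 x\<close> are adjacent in the common link of
        \<open>Y\<close>.\<close>
      obtain \<mu> where mu: "\<mu> \<in> F 0" "\<forall>x\<in>X. \<forall>y\<in>Y. {\<phi>1 x, \<mu> x, y} \<in> H"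
        using mate[of 0 \<phi>1] p1 d by auto
      then have "{\<phi>1 x, \<mu> x, h (Inl u)} \<in> H" using x(1) hu by blast
      then have tri: "{h (Inl u), x, \<phi>1 x} \<in> H" using F0 mu(1) by (simp add: insert_commute)
      have xO: "x \<in> Own x" "\<phi>1 x \<in> Own x"
      proof -
        show "x \<in> Own x" unfolding Own_def using F0 by (intro UN_I[of 0]) auto
        show "\<phi>1 x \<in> Own x" unfolding Own_def using p1 d by (intro UN_I[of 1]) auto
      qed
      have nK: "x \<notin> K" "\<phi>1 x \<notin> K" using OK[OF x(1)] xO by blast+
      let ?P' = "insert x (insert (\<phi>1 x) P)"
      have PK: "?P' \<inter> K = P \<inter> K" using nK by blast
      show ?thesis
      proof (rule place[of x "\<phi>1 x"])
        show "x \<notin> P" "\<phi>1 x \<notin> P" using xO x(2) by blast+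
        have "good m' x" unfolding good_def using F0 x(1) by (intro disjI1 exI[of _ 0]) auto
        then show "if v \<in> I then x \<in> Y else good m' x" using vI by simp
        show "card (?P' \<inter> K) + 1 \<le> m'" using cK PK mm by simp
        fix z assume z: "z \<in> X"
        show "card (?P' \<inter> (K \<union> Own z)) \<le> m' + 1"
        proof (cases "z = x")
          case True
          \<comment> \<open>At most \<open>m - 1\<close> hubs are used, and the fresh owner adds
            only \<open>x\<close> and \<open>\<phi>1 x\<close>; this is the origin of the bound
            \<open>m + 1\<close>.\<close>
          have "?P' \<inter> (K \<union> Own z) \<subseteq> insert x (insert (\<phi>1 x) (P \<inter> K))"
            using x(2) True by blast
          then have "card (?P' \<inter> (K \<union> Own z)) \<le> card (insert x (insert (\<phi>1 x) (P \<inter> K)))"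
            using P(1) by (intro card_mono) auto
          also have "\<dots> \<le> card (P \<inter> K) + 2"
            using P(1) by (simp add: card_insert_if)
          finally show ?thesis using cK mm by simp
        next
          case False
          have "?P' \<inter> (K \<union> Own z) = P \<inter> (K \<union> Own z)"
            using nK xO Osep[OF z x(1) False] by blast
          then show ?thesis using cO[OF z] mm by simp
        qed
      qed (rule tri)
    next
      case False
      then have mm: "m' = Suc m" "m < d" using m' by simp_all
      have "good m (h (Inl u))" using h(2) leaf.hyps(2) False by simp
      from ext[OF this mm(2) uP P cO] obtain c where c: "c \<notin> P" "good m' c"
        "\<forall>y\<in>Y. {h (Inl u), c, y} \<in> H" unfolding mm(1) by blast
      have count: "card (insert y (insert c P) \<inter> A) \<le> card (P \<inter> A) + 1" if "y \<notin> A" for A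
        using card_insert_Int(2)[of "insert c P" y A] card_insert_Int(1)[OF P(1), of c A] that P(1)
        by simp
      have yK: "y \<notin> K" using y(1) K(2) by blast
      have c1: "card (insert y (insert c P) \<inter> K) + 1 \<le> m'"
        using count[OF yK] cK mm(1) by linarith
      have c2: "card (insert y (insert c P) \<inter> (K \<union> Own x)) \<le> m' + 1" if "x \<in> X" for x
      proof -
        have "y \<notin> K \<union> Own x" using yK Oy[OF that y(1)] by blast
        from count[OF this] cO[OF that] mm(1) show ?thesis by linarith
      qed
      have tri: "{h (Inl u), c, y} \<in> H" using c(3) y(1) by blast
      \<comment> \<open>Either way one link vertex \<open>c\<close> and one vertex \<open>y\<close>
        of \<open>Y\<close> are spent: \<open>v\<close> goes to \<open>Y\<close> if it lies in
        \<open>I\<close>, and otherwise the apex over the new edge does.\<close>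
      show ?thesis
      proof (cases "v \<in> I")
        case True
        show ?thesis
          by (rule place[of y c]) (use y c True c1 c2 tri in \<open>simp_all add: insert_commute\<close>)
      next
        case False
        show ?thesis
          by (rule place[of c y]) (use y c False c1 c2 tri in \<open>simp_all add: insert_commute\<close>)
      qed
    qed
  qed
  from this[OF tr order_refl ind I(2)] show ?thesis by blast
qed

section \<open>Building layers of link vertices\<close>

lemma children_mono:
  assumes "children d H X Y \<phi> G K" "X' \<subseteq> X" "Y' \<subseteq> Y" "K \<subseteq> K'"
  shows "children d H X' Y' \<phi> G K'"
proof -
  obtain \<psi> where "\<forall>x\<in>X. inj_on (\<lambda>l. \<psi> l x) {..<d}"
    "\<forall>l<d. \<forall>x\<in>X. \<forall>y\<in>Y. {\<phi> x, \<psi> l x, y} \<in> H"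
    "\<forall>l<d. \<psi> l \<in> G \<or> (\<exists>c\<in>K. \<forall>x\<in>X. \<psi> l x = c)"
    using assms(1) by (auto simp: children_def)
  moreover from this(3) have "\<forall>l<d. \<psi> l \<in> G \<or> (\<exists>c\<in>K'. \<forall>x\<in>X'. \<psi> l x = c)"
    using assms(2,4) by (meson subsetD)
  ultimately show ?thesis unfolding children_def using assms(2,3)
    by (intro exI[of _ \<psi>]) blast
qed

lemma layeredD:
  assumes "layered d H n X Y F K"
  shows "i \<le> n \<Longrightarrow> finite (F i)" "i \<le> n \<Longrightarrow> card (F i) \<le> d ^ i"
    "i \<le> n \<Longrightarrow> \<phi> \<in> F i \<Longrightarrow> inj_on \<phi> X"
    "i < n \<Longrightarrow> \<phi> \<in> F i \<Longrightarrow> children d H X Y \<phi> (F (Suc i)) K"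
    "i < n \<Longrightarrow> \<phi> \<in> F (Suc i) \<Longrightarrow> \<exists>\<mu>\<in>F i. \<forall>x\<in>X. \<forall>y\<in>Y. {\<phi> x, \<mu> x, y} \<in> H"
  using assms unfolding layered_def by blast+

lemma layered_mono:
  assumes "layered d H n X Y F K" "X' \<subseteq> X" "Y' \<subseteq> Y"
  shows "layered d H n X' Y' F K"
  unfolding layered_def
proof (intro conjI allI impI ballI)
  fix i \<phi> assume i: "i < n"
  { assume "\<phi> \<in> F i"
    then have "children d H X Y \<phi> (F (Suc i)) K" using assms(1) i by (simp add: layered_def)
    then show "children d H X' Y' \<phi> (F (Suc i)) K"
      using assms(2,3) by (rule children_mono) simp }
  { assume "\<phi> \<in> F (Suc i)"
    then obtain \<mu> where "\<mu> \<in> F i" "\<forall>x\<in>X. \<forall>y\<in>Y. {\<phi> x, \<mu> x, y} \<in> H"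
      using assms(1) i unfolding layered_def by blast
    then show "\<exists>\<mu>\<in>F i. \<forall>x\<in>X'. \<forall>y\<in>Y'. {\<phi> x, \<mu> x, y} \<in> H" using assms(2,3) by blast }
next
  fix i \<phi> assume "i \<le> n" "\<phi> \<in> F i"
  then have "inj_on \<phi> X" using assms(1) by (simp add: layered_def)
  then show "inj_on \<phi> X'" using assms(2) by (rule inj_on_subset)
next
  have "K \<inter> Y = {}" using assms(1) by (simp add: layered_def)
  then show "K \<inter> Y' = {}" using assms(3) by blast
  show "F 0 = {id}" "finite K" "card K \<le> n * d ^ n" using assms(1) by (simp_all add: layered_def)
qed (use layeredD(1,2)[OF assms(1)] in auto)

text \<open>The \<open>d\<close> common neighbours of every \<open>\<phi> x\<close> are enumerated,
  which gives at most \<open>d ^ Suc n\<close> functions of \<open>x\<close>. After thinning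
  \<open>X\<close>, the injective ones form the next layer and the constant ones yield hubs.\<close>

lemma layered_step:
  fixes H :: "'b set set"
  assumes H: "triple_system H" and lay: "layered d H n X Y F K" and d: "1 \<le> d" and s: "1 \<le> s"
    and com: "\<forall>\<phi>\<in>F n. \<forall>x\<in>X. common d H (\<phi> x) Y"
    and X: "finite X" "s ^ (2 ^ (d ^ Suc n)) \<le> card X"
  shows "\<exists>X'\<subseteq>X. card X' = s \<and>
    (\<exists>F' K'. layered d H (Suc n) X' Y F' K' \<and> (\<forall>i\<le>n. F' i = F i))"
proof -
  have fFn: "finite (F n)" "card (F n) \<le> d ^ n" using lay by (simp_all add: layered_def)
  have "\<exists>e. inj_on e {..<d} \<and> (\<forall>l<d. \<forall>y\<in>Y. {\<phi> x, e l, y} \<in> H)" if "\<phi> \<in> F n" "x \<in> X" for \<phi> x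
  proof -
    from com that obtain C where C: "finite C" "card C = d" "\<forall>c\<in>C. \<forall>y\<in>Y. {\<phi> x, c, y} \<in> H"
      unfolding common_def by blast
    from ex_bij_betw_nat_finite[OF C(1)] C(2) obtain e where "bij_betw e {..<d} C"
      by (auto simp: atLeast0LessThan)
    then have "inj_on e {..<d}" "\<forall>l<d. e l \<in> C" by (auto simp: bij_betw_def)
    with C(3) show ?thesis by blast
  qed
  then have "\<exists>e. \<forall>\<phi>\<in>F n. \<forall>x\<in>X. inj_on (e \<phi> x) {..<d} \<and> (\<forall>l<d. \<forall>y\<in>Y. {\<phi> x, e \<phi> x l, y} \<in> H)"
    by metis
  then obtain e where e: "\<And>\<phi> x. \<phi> \<in> F n \<Longrightarrow> x \<in> X \<Longrightarrow> inj_on (e \<phi> x) {..<d}"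
    "\<And>\<phi> x l y. \<phi> \<in> F n \<Longrightarrow> x \<in> X \<Longrightarrow> l < d \<Longrightarrow> y \<in> Y \<Longrightarrow> {\<phi> x, e \<phi> x l, y} \<in> H"
    by blast
  define \<psi> where "\<psi> \<phi> l x = e \<phi> x l" for \<phi> l x
  define Q where "Q = (\<lambda>(\<phi>, l). \<psi> \<phi> l) ` (F n \<times> {..<d})"
  have fQ: "finite Q" using fFn by (simp add: Q_def)
  have "card Q \<le> card (F n \<times> {..<d})" unfolding Q_def by (rule card_image_le) (use fFn in simp)
  also have "\<dots> \<le> d ^ n * d" using fFn(2) by (simp add: card_cartesian_product)
  finally have cQ: "card Q \<le> d ^ Suc n" by (simp add: mult.commute)
  have "s ^ (2 ^ card Q) \<le> s ^ (2 ^ (d ^ Suc n))"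
    using cQ s by (intro power_increasing) auto
  then have "s ^ (2 ^ card Q) \<le> card X" using X(2) by linarith
  from thin_functions[OF fQ X(1) this] obtain X' where X': "X' \<subseteq> X" "card X' = s"
    "\<forall>\<phi>\<in>Q. inj_on \<phi> X' \<or> (\<exists>c. \<forall>x\<in>X'. \<phi> x = c)" by blast
  from X'(2) s obtain x0 where x0: "x0 \<in> X'" by (metis card.empty equals0I not_one_le_zero)
  define F' where "F' = F(Suc n := {q \<in> Q. inj_on q X'})"
  \<comment> \<open>Evaluation at \<open>x0\<close> reads off the constants. Values of the injective
    functions are collected as well; they respect the size bound and avoid \<open>Y\<close>
    too.\<close>
  define K' where "K' = K \<union> (\<lambda>q. q x0) ` Q"
  have F': "F' i = F i" if "i \<le> n" for i using that by (simp add: F'_def)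
  have "layered d H (Suc n) X' Y F' K'"
    unfolding layered_def
  proof (intro conjI allI impI ballI)
    show "F' 0 = {id}" using F'[of 0] lay by (simp add: layered_def)
    show "finite K'" using lay fQ by (simp add: K'_def layered_def)
    have "card ((\<lambda>q. q x0) ` Q) \<le> d ^ Suc n" using card_image_le[OF fQ] cQ le_trans by blast
    moreover have "card K \<le> n * d ^ n" using lay by (simp add: layered_def)
    moreover have "n * d ^ n \<le> n * d ^ Suc n" using d by simp
    ultimately have "card K + card ((\<lambda>q. q x0) ` Q) \<le> Suc n * d ^ Suc n"
      unfolding mult_Suc by linarith
    then show "card K' \<le> Suc n * d ^ Suc n"
      unfolding K'_def using card_Un_le le_trans by blast
    have "q x0 \<notin> Y" if "q \<in> Q" for q
    proof
      assume y: "q x0 \<in> Y"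
      from that obtain \<phi> l where q: "\<phi> \<in> F n" "l < d" "q = \<psi> \<phi> l" by (auto simp: Q_def)
      then have "{\<phi> x0, q x0, q x0} \<in> H" using e(2)[OF q(1) _ q(2) y, of x0] x0 X'(1)
        by (auto simp: \<psi>_def)
      then show False using triple_distinct(3)[OF H] by blast
    qed
    then show "K' \<inter> Y = {}" using lay by (auto simp: K'_def layered_def)
  next
    fix i assume i: "i \<le> Suc n"
    have *: "finite (F' i) \<and> card (F' i) \<le> d ^ i \<and> (\<forall>\<phi>\<in>F' i. inj_on \<phi> X')"
    proof (cases "i = Suc n")
      case True
      have "card {q \<in> Q. inj_on q X'} \<le> card Q" using fQ by (intro card_mono) auto
      then show ?thesis using True fQ cQ by (simp add: F'_def)
    next
      case False
      then have i: "i \<le> n" using i by simp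
      have "layered d H n X' Y F K" using layered_mono[OF lay X'(1) order_refl] .
      then show ?thesis using i F'[OF i] by (simp add: layered_def)
    qed
    show "finite (F' i)" "card (F' i) \<le> d ^ i" using * by blast+
    fix \<phi> assume "\<phi> \<in> F' i"
    with * show "inj_on \<phi> X'" by blast
  next
    fix i \<phi> assume i: "i < Suc n" "\<phi> \<in> F' i"
    then have F'i: "F' i = F i" using F'[of i] by simp
    show "children d H X' Y \<phi> (F' (Suc i)) K'"
    proof (cases "i = n")
      case True
      then have p: "\<phi> \<in> F n" using i F'i by simp
      have "\<psi> \<phi> l \<in> F' (Suc n) \<or> (\<exists>c\<in>K'. \<forall>x\<in>X'. \<psi> \<phi> l x = c)" if "l < d" for l
      proof -
        have q: "\<psi> \<phi> l \<in> Q" using p that by (auto simp: Q_def)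
        with X'(3) consider "inj_on (\<psi> \<phi> l) X'" | c where "\<forall>x\<in>X'. \<psi> \<phi> l x = c" by blast
        then show ?thesis
        proof cases
          case 1 then show ?thesis using q by (simp add: F'_def)
        next
          case 2
          then have "\<psi> \<phi> l x0 = c" using x0 by blast
          moreover have "\<psi> \<phi> l x0 \<in> K'" using q by (auto simp: K'_def)
          ultimately show ?thesis using 2 by blast
        qed
      qed
      moreover have "\<forall>x\<in>X'. inj_on (\<lambda>l. \<psi> \<phi> l x) {..<d}"
        using e(1)[OF p] X'(1) by (auto simp: \<psi>_def)
      moreover have "\<forall>l<d. \<forall>x\<in>X'. \<forall>y\<in>Y. {\<phi> x, \<psi> \<phi> l x, y} \<in> H"
        using e(2)[OF p] X'(1) by (auto simp: \<psi>_def)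
      ultimately show ?thesis unfolding children_def True by (intro exI[of _ "\<psi> \<phi>"]) blast
    next
      case False
      then have "i < n" using i by simp
      then have "children d H X Y \<phi> (F (Suc i)) K" "F' (Suc i) = F (Suc i)"
        using layeredD(4)[OF lay] i F'i F'[of "Suc i"] by simp_all
      then show ?thesis using children_mono[OF _ X'(1) order_refl, of d H Y \<phi> "F (Suc i)" K K']
        by (simp add: K'_def)
    qed
  next
    fix i \<phi> assume i: "i < Suc n" "\<phi> \<in> F' (Suc i)"
    then have F'i: "F' i = F i" using F'[of i] by simp
    show "\<exists>\<mu>\<in>F' i. \<forall>x\<in>X'. \<forall>y\<in>Y. {\<phi> x, \<mu> x, y} \<in> H"
    proof (cases "i = n")
      case True
      then have "\<phi> \<in> Q" using i by (simp add: F'_def)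
      then obtain \<mu> l where q: "\<mu> \<in> F n" "l < d" "\<phi> = \<psi> \<mu> l" by (auto simp: Q_def)
      have "{\<phi> x, \<mu> x, y} \<in> H" if "x \<in> X'" "y \<in> Y" for x y
        using e(2)[OF q(1) _ q(2) that(2), of x] that(1) X'(1) q(3)
        by (auto simp: \<psi>_def insert_commute)
      then show ?thesis using q(1) True F'i by blast
    next
      case False
      then have "i < n" using i by simp
      moreover from this have "\<phi> \<in> F (Suc i)" using i(2) F'[of "Suc i"] by simp
      ultimately obtain \<mu> where "\<mu> \<in> F i" "\<forall>x\<in>X. \<forall>y\<in>Y. {\<phi> x, \<mu> x, y} \<in> H"
        using layeredD(5)[OF lay] by blast
      then show ?thesis using F'i X'(1) by blast
    qed
  qed
  with X' F' show ?thesis by blast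
qed

text \<open>Supplies hypothesis \<open>com\<close> of \<open>layered_step\<close> for the newest
  layer. If for one \<open>\<phi>\<close> many vertices \<open>\<phi> x\<close> are rich, then they
  and \<open>Y'\<close> are rich towards each other, because the third vertices
  \<open>\<mu> x\<close> are distinct, and the expansion embeds. Otherwise each
  \<open>\<phi>\<close> spoils only few \<open>x\<close>.\<close>

lemma layered_common:
  fixes H :: "'b set set"
  assumes H: "triple_system H" "full d H" and tr: "rooted r V E" and s: "1 \<le> s"
    and lay: "layered d H (Suc n) X Y F K" and fin: "finite X" "finite Y"
    and X: "s + d ^ Suc n * (4 * card V) \<le> card X"
    and Y: "(4 * card V + s) ^ (2 ^ (d * (d ^ Suc n * (s + d ^ Suc n * (4 * card V))))) \<le> card Y"
  shows "(\<exists>h. embeds V E H h) \<or> (\<exists>X'\<subseteq>X. \<exists>Y'\<subseteq>Y. s \<le> card X' \<and> s \<le> card Y' \<and>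
    (\<forall>\<phi>\<in>F (Suc n). \<forall>x\<in>X'. common d H (\<phi> x) Y'))"
proof -
  define N where "N = 4 * card V"
  define m where "m = s + d ^ Suc n * N"
  have V: "card V > 0" using rooted_graph[OF tr] by (auto simp: card_gt_0_iff)
  have F: "finite (F (Suc n))" "card (F (Suc n)) \<le> d ^ Suc n"
    and inj: "\<And>\<phi>. \<phi> \<in> F (Suc n) \<Longrightarrow> inj_on \<phi> X" "\<And>\<phi>. \<phi> \<in> F n \<Longrightarrow> inj_on \<phi> X"
    and mate: "\<And>\<phi>. \<phi> \<in> F (Suc n) \<Longrightarrow> \<exists>\<mu>\<in>F n. \<forall>x\<in>X. \<forall>y\<in>Y. {\<phi> x, \<mu> x, y} \<in> H"
    using layeredD[OF lay] by (blast intro: order_refl le_SucI lessI)+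
  have "m \<le> card X" using X by (simp add: m_def N_def)
  then obtain X1 where X1: "X1 \<subseteq> X" "card X1 = m" "finite X1"
    by (rule obtain_subset_with_card_n)
  define U where "U = (\<Union>\<phi>\<in>F (Suc n). \<phi> ` X1)"
  have fU: "finite U" using F X1 by (simp add: U_def)
  have "card U \<le> (\<Sum>\<phi>\<in>F (Suc n). m)"
    unfolding U_def using F X1 card_image_le[OF X1(3)]
    by (intro order_trans[OF card_UN_le] sum_mono) auto
  also have "\<dots> \<le> d ^ Suc n * m" using F(2) by simp
  finally have cU: "card U \<le> d ^ Suc n * m" .
  have "(N + s) ^ (2 ^ (d * card U)) \<le> (N + s) ^ (2 ^ (d * (d ^ Suc n * m)))"
    using cU s by (intro power_increasing mult_le_mono2) auto
  also have "\<dots> \<le> card Y" using Y by (simp only: N_def m_def)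
  finally have Ybig: "(N + s) ^ (2 ^ (d * card U)) \<le> card Y" .
  have deg: "\<forall>u\<in>U. \<forall>y\<in>Y. d \<le> card (colink H u y)"
  proof (intro ballI)
    fix u y assume "u \<in> U" and y: "y \<in> Y"
    then obtain \<phi> x where p: "\<phi> \<in> F (Suc n)" "x \<in> X" "u = \<phi> x" using X1(1) by (auto simp: U_def)
    with mate y obtain \<mu> where "{\<phi> x, \<mu> x, y} \<in> H" by blast
    then have "\<mu> x \<in> colink H u y" using p(3) by (simp add: colink_def insert_commute)
    then show "d \<le> card (colink H u y)" using H(2) by (auto simp: full_def)
  qed
  from rich_or_common[OF fU H(1) deg fin(2) Ybig] obtain Y' where
    Y': "Y' \<subseteq> Y" "card Y' = N + s" "\<forall>u\<in>U. rich H u Y' \<or> common d H u Y'" by blast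
  define R where "R \<phi> = {x \<in> X1. rich H (\<phi> x) Y'}" for \<phi>
  show ?thesis
  proof (cases "\<exists>\<phi>\<in>F (Suc n). N \<le> card (R \<phi>)")
    case True
    then obtain \<phi> where p: "\<phi> \<in> F (Suc n)" "N \<le> card (R \<phi>)" by blast
    with mate obtain \<mu> where mu: "\<mu> \<in> F n" "\<forall>x\<in>X. \<forall>y\<in>Y. {\<phi> x, \<mu> x, y} \<in> H" by blast
    have RX: "R \<phi> \<subseteq> X" using X1(1) by (auto simp: R_def)
    have i: "inj_on \<phi> (R \<phi>)" "inj_on \<mu> (R \<phi>)"
      using inj(1)[OF p(1)] inj(2)[OF mu(1)] RX inj_on_subset by blast+
    have "rich H y (\<phi> ` R \<phi>)" if "y \<in> Y'" for y
      unfolding rich_def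
    proof (intro exI conjI ballI)
      \<comment> \<open>The third vertex for \<open>y\<close> and \<open>\<phi> x\<close> is
        \<open>\<mu> x\<close>, and \<open>?g\<close> recovers \<open>x\<close> from
        \<open>\<phi> x\<close>.\<close>
      let ?g = "the_inv_into (R \<phi>) \<phi>"
      show "inj_on (\<mu> \<circ> ?g) (\<phi> ` R \<phi>)"
        using i by (intro comp_inj_on inj_on_the_inv_into) auto
      fix u assume "u \<in> \<phi> ` R \<phi>"
      then obtain x where x: "x \<in> R \<phi>" "u = \<phi> x" by blast
      then have "{\<phi> x, \<mu> x, y} \<in> H" using mu(2) RX Y'(1) that by blast
      then show "{y, u, (\<mu> \<circ> ?g) u} \<in> H"
        using x the_inv_into_f_f[OF i(1) x(1)] by (simp add: insert_commute)
    qed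
    moreover have "\<forall>u\<in>\<phi> ` R \<phi>. rich H u Y'" by (auto simp: R_def)
    moreover have "card (\<phi> ` R \<phi>) = card (R \<phi>)" using i(1) by (rule card_image)
    ultimately have "\<exists>h. embeds V E H h"
      using p(2) Y'(2) by (intro rich_rich_embeds[OF H(1) tr, of "\<phi> ` R \<phi>" Y']) (auto simp: N_def)
    then show ?thesis ..
  next
    case False
    let ?R = "\<Union>\<phi>\<in>F (Suc n). R \<phi>"
    have fR: "finite ?R" using F X1(3) by (auto simp: R_def)
    have "card ?R \<le> (\<Sum>\<phi>\<in>F (Suc n). N)"
      using False F by (intro order_trans[OF card_UN_le] sum_mono) (auto simp: not_le less_imp_le)
    also have "\<dots> \<le> d ^ Suc n * N" using F(2) by simp
    finally have "s \<le> card X1 - card ?R" using X1(2) by (simp add: m_def)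
    then have "s \<le> card (X1 - ?R)" using diff_card_le_card_Diff[OF fR, of X1] by linarith
    moreover have "\<forall>\<phi>\<in>F (Suc n). \<forall>x\<in>X1 - ?R. common d H (\<phi> x) Y'"
    proof (intro ballI)
      fix \<phi> x assume p: "\<phi> \<in> F (Suc n)" "x \<in> X1 - ?R"
      then have "\<phi> x \<in> U" by (auto simp: U_def)
      moreover have "\<not> rich H (\<phi> x) Y'" using p by (auto simp: R_def)
      ultimately show "common d H (\<phi> x) Y'" using Y'(3) by blast
    qed
    moreover have "X1 - ?R \<subseteq> X" using X1(1) by blast
    moreover have "s \<le> card Y'" using Y'(2) by simp
    ultimately show ?thesis using Y'(1) by blast
  qed
qed

text \<open>Layers are added one by one by \<open>layered_common\<close> and
  \<open>layered_step\<close>. Each addition thins both sides, so the induction has to run over all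
  target sizes \<open>s\<close>.\<close>

lemma layered_exists:
  assumes tr: "rooted r V E" and ind: "\<forall>e\<in>E. \<not> e \<subseteq> I" and w: "weight I V E = d" and d: "1 \<le> d"
  shows "\<exists>S. \<forall>(H :: 'b set set) X Y. triple_system H \<longrightarrow> full d H \<longrightarrow> finite X \<longrightarrow> finite Y \<longrightarrow>
      S \<le> card X \<longrightarrow> S \<le> card Y \<longrightarrow> (\<forall>x\<in>X. \<forall>y\<in>Y. colink H x y \<noteq> {}) \<longrightarrow>
      (\<exists>h. embeds V E H h) \<or>
      (\<exists>X' Y' F K. finite X' \<and> finite Y' \<and> s \<le> card X' \<and> s \<le> card Y' \<and>
         layered d H (Suc n) X' Y' F K \<and> F 1 \<noteq> {})"
proof (induction n arbitrary: s)
  case 0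
  define s1 where "s1 = Suc s + 2 * card V"
  define s0 where "s0 = s1 ^ (2 ^ (d ^ Suc 0)) + s1"
  obtain S where S: "\<forall>(H :: 'b set set) X Y. triple_system H \<longrightarrow> full d H \<longrightarrow> finite X \<longrightarrow> finite Y \<longrightarrow>
      S \<le> card X \<longrightarrow> S \<le> card Y \<longrightarrow> (\<forall>x\<in>X. \<forall>y\<in>Y. colink H x y \<noteq> {}) \<longrightarrow>
      (\<exists>h. embeds V E H h) \<or>
      (\<exists>X' Y'. finite X' \<and> finite Y' \<and> card X' = s0 \<and> card Y' = s0 \<and> (\<forall>x\<in>X'. common d H x Y'))"
    using common_grid[OF tr, of d s0] by blast
  show ?case
  proof (intro exI[of _ S] allI impI)
    fix H :: "'b set set" and X Y
    assume H: "triple_system H" "full d H" and h: "finite X" "finite Y"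
      "S \<le> card X" "S \<le> card Y" "\<forall>x\<in>X. \<forall>y\<in>Y. colink H x y \<noteq> {}"
    have "(\<exists>h. embeds V E H h) \<or>
      (\<exists>X' Y'. finite X' \<and> finite Y' \<and> card X' = s0 \<and> card Y' = s0 \<and> (\<forall>x\<in>X'. common d H x Y'))"
      using S H h by blast
    then show "(\<exists>h. embeds V E H h) \<or>
      (\<exists>X' Y' F K. finite X' \<and> finite Y' \<and> s \<le> card X' \<and> s \<le> card Y' \<and>
         layered d H (Suc 0) X' Y' F K \<and> F 1 \<noteq> {})"
    proof (elim disjE exE conjE)
      fix X' Y' assume X': "finite X'" "finite Y'" "card X' = s0" "card Y' = s0"
        "\<forall>x\<in>X'. common d H x Y'"
      have l0: "layered d H 0 X' Y' (\<lambda>_. {id}) {}" by (simp add: layered_def)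
      have "1 \<le> s1" by (simp add: s1_def)
      moreover have "\<forall>\<phi>\<in>{id}. \<forall>x\<in>X'. common d H (\<phi> x) Y'" using X'(5) by simp
      moreover have "s1 ^ (2 ^ (d ^ Suc 0)) \<le> card X'" unfolding X'(3) s0_def by linarith
      ultimately obtain X2 F K where X2: "X2 \<subseteq> X'" "card X2 = s1"
        and lay: "layered d H (Suc 0) X2 Y' F K" and F0: "F 0 = {id}"
        using layered_step[OF H(1) l0 d, of s1] X'(1) by auto
      have big: "s \<le> card X2" "s \<le> card Y'" "2 * card V \<le> card X2" "2 * card V \<le> card Y'"
        using X2(2) X'(4) by (simp_all add: s1_def s0_def)
      show ?thesis
      proof (cases "F 1 = {}")
        case False
        then show ?thesis using lay big X2(1) X'(1,2) finite_subset by blast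
      next
        \<comment> \<open>All \<open>d\<close> neighbour functions of \<open>id\<close> are
          constant, so their values form a complete tripartite system with \<open>X2\<close> and
          \<open>Y'\<close>.\<close>
        case True
        have "children d H X2 Y' id (F (Suc 0)) K" using lay F0 by (simp add: layered_def)
        then obtain \<psi> where psi: "\<forall>x\<in>X2. inj_on (\<lambda>l. \<psi> l x) {..<d}"
          "\<forall>l<d. \<forall>x\<in>X2. \<forall>y\<in>Y'. {x, \<psi> l x, y} \<in> H" "\<forall>l<d. \<exists>c\<in>K. \<forall>x\<in>X2. \<psi> l x = c"
          using True by (auto simp: children_def)
        have "X2 \<noteq> {}" using X2(2) by (auto simp: s1_def)
        then obtain x0 where x0: "x0 \<in> X2" by blast
        let ?C = "(\<lambda>l. \<psi> l x0) ` {..<d}"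
        have "card ?C = card {..<d}" using psi(1) x0 by (intro card_image) blast
        then have "card ?C = d" by simp
        moreover have "{x, c, y} \<in> H" if xy: "x \<in> X2" "c \<in> ?C" "y \<in> Y'" for x c y
        proof -
          from xy(2) obtain l where l: "l < d" "c = \<psi> l x0" by blast
          then have "\<psi> l x = c" using psi(3) x0 xy(1) by metis
          then show ?thesis using psi(2) l(1) xy by blast
        qed
        ultimately have "\<exists>h. embeds V E H h"
          using big w by (intro tripartite_embeds[OF H(1) tr ind, of ?C X2 Y']) auto
        then show ?thesis ..
      qed
    qed blast
  qed
next
  case (Suc n)
  define s1 where "s1 = Suc s"
  define s2 where "s2 = s1 ^ (2 ^ (d ^ Suc (Suc n))) + s1"
  define T where "T = (s2 + d ^ Suc n * (4 * card V))
    + (4 * card V + s2) ^ (2 ^ (d * (d ^ Suc n * (s2 + d ^ Suc n * (4 * card V)))))"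
  obtain S where S: "\<forall>(H :: 'b set set) X Y. triple_system H \<longrightarrow> full d H \<longrightarrow> finite X \<longrightarrow> finite Y \<longrightarrow>
      S \<le> card X \<longrightarrow> S \<le> card Y \<longrightarrow> (\<forall>x\<in>X. \<forall>y\<in>Y. colink H x y \<noteq> {}) \<longrightarrow>
      (\<exists>h. embeds V E H h) \<or>
      (\<exists>X' Y' F K. finite X' \<and> finite Y' \<and> T \<le> card X' \<and> T \<le> card Y' \<and>
         layered d H (Suc n) X' Y' F K \<and> F 1 \<noteq> {})"
    using Suc.IH[of T] by blast
  show ?case
  proof (intro exI[of _ S] allI impI)
    fix H :: "'b set set" and X Y
    assume H: "triple_system H" "full d H" and h: "finite X" "finite Y"
      "S \<le> card X" "S \<le> card Y" "\<forall>x\<in>X. \<forall>y\<in>Y. colink H x y \<noteq> {}"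
    have "(\<exists>h. embeds V E H h) \<or>
      (\<exists>X' Y' F K. finite X' \<and> finite Y' \<and> T \<le> card X' \<and> T \<le> card Y' \<and>
         layered d H (Suc n) X' Y' F K \<and> F 1 \<noteq> {})"
      using S H h by blast
    then show "(\<exists>h. embeds V E H h) \<or>
      (\<exists>X' Y' F K. finite X' \<and> finite Y' \<and> s \<le> card X' \<and> s \<le> card Y' \<and>
         layered d H (Suc (Suc n)) X' Y' F K \<and> F 1 \<noteq> {})"
    proof (elim disjE exE conjE)
      fix X1 Y1 F K assume X1: "finite X1" "finite Y1" "T \<le> card X1" "T \<le> card Y1"
        and lay: "layered d H (Suc n) X1 Y1 F K" and F1: "F 1 \<noteq> {}"
      have "1 \<le> s2" by (simp add: s2_def s1_def)
      moreover have "s2 + d ^ Suc n * (4 * card V) \<le> card X1"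
        using X1(3) unfolding T_def by linarith
      moreover have "(4 * card V + s2) ^ (2 ^ (d * (d ^ Suc n * (s2 + d ^ Suc n * (4 * card V)))))
          \<le> card Y1"
        using X1(4) unfolding T_def by linarith
      ultimately have "(\<exists>h. embeds V E H h) \<or> (\<exists>X'\<subseteq>X1. \<exists>Y'\<subseteq>Y1. s2 \<le> card X' \<and> s2 \<le> card Y' \<and>
          (\<forall>\<phi>\<in>F (Suc n). \<forall>x\<in>X'. common d H (\<phi> x) Y'))"
        using layered_common[OF H tr _ lay X1(1,2), of s2] by blast
      then show ?thesis
      proof (elim disjE exE conjE)
        fix X2 Y2 assume X2: "X2 \<subseteq> X1" "Y2 \<subseteq> Y1" "s2 \<le> card X2" "s2 \<le> card Y2"
          and com: "\<forall>\<phi>\<in>F (Suc n). \<forall>x\<in>X2. common d H (\<phi> x) Y2"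
        have fin: "finite X2" "finite Y2" using X2(1,2) X1(1,2) finite_subset by blast+
        have lay2: "layered d H (Suc n) X2 Y2 F K" using lay X2(1,2) by (rule layered_mono)
        have "s1 ^ (2 ^ (d ^ Suc (Suc n))) \<le> card X2" using X2(3) unfolding s2_def by linarith
        moreover have "1 \<le> s1" by (simp add: s1_def)
        ultimately obtain X3 F' K' where X3: "X3 \<subseteq> X2" "card X3 = s1"
          and lay3: "layered d H (Suc (Suc n)) X3 Y2 F' K'" and F': "\<forall>i\<le>Suc n. F' i = F i"
          using layered_step[OF H(1) lay2 d _ com fin(1), of s1] by blast
        have "F' 1 \<noteq> {}" using F' F1 by simp
        moreover have "s \<le> card X3" "s \<le> card Y2"
          using X3(2) X2(4) by (simp_all add: s1_def s2_def)
        moreover have "finite X3" using X3(1) fin(1) by (rule finite_subset)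
        ultimately show ?thesis using lay3 fin(2) by blast
      qed blast
    qed blast
  qed
qed

text \<open>Given layers up to \<open>d\<close>, it remains to drop the points of \<open>X\<close>
  that some function maps to a hub and to separate the functions; then \<open>layered_embeds\<close>
  applies.\<close>

lemma grid_embeds:
  assumes tr: "rooted r V E" and ind: "\<forall>e\<in>E. \<not> e \<subseteq> I" and r: "r \<in> I"
    and w: "weight I V E = d"
  shows "\<exists>S. \<forall>(H :: 'b set set) X Y. triple_system H \<longrightarrow> full d H \<longrightarrow> finite X \<longrightarrow> finite Y \<longrightarrow>
      S \<le> card X \<longrightarrow> S \<le> card Y \<longrightarrow> (\<forall>x\<in>X. \<forall>y\<in>Y. colink H x y \<noteq> {}) \<longrightarrow>
      (\<exists>h. embeds V E H h)"
proof -
  have "r \<in> V \<inter> I" "finite (V \<inter> I)" using rooted_graph[OF tr] r by auto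
  then have "card (V \<inter> I) > 0" by (auto simp: card_gt_0_iff)
  then have d: "1 \<le> d" using w by (simp add: weight_def)
  \<comment> \<open>\<open>f\<close> bounds the number of functions in all layers, \<open>k\<close>
    the number of hubs, and \<open>N\<close> is the size that \<open>separate_functions\<close>
    needs.\<close>
  define f where "f = Suc d * d ^ d"
  define k where "k = d * d ^ d"
  define N where "N = 2 * card V * (f * f + 1)"
  define s where "s = f * k + N"
  obtain n where n: "d = Suc n" using d by (cases d) auto
  obtain S where S: "\<forall>(H :: 'b set set) X Y. triple_system H \<longrightarrow> full d H \<longrightarrow> finite X \<longrightarrow> finite Y \<longrightarrow>
      S \<le> card X \<longrightarrow> S \<le> card Y \<longrightarrow> (\<forall>x\<in>X. \<forall>y\<in>Y. colink H x y \<noteq> {}) \<longrightarrow>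
      (\<exists>h. embeds V E H h) \<or>
      (\<exists>X' Y' F K. finite X' \<and> finite Y' \<and> s \<le> card X' \<and> s \<le> card Y' \<and>
         layered d H (Suc n) X' Y' F K \<and> F 1 \<noteq> {})"
    using layered_exists[OF tr ind w d, of s n] by blast
  show ?thesis
  proof (intro exI[of _ S] allI impI)
    fix H :: "'b set set" and X Y
    assume H: "triple_system H" "full d H" and h: "finite X" "finite Y"
      "S \<le> card X" "S \<le> card Y" "\<forall>x\<in>X. \<forall>y\<in>Y. colink H x y \<noteq> {}"
    have "(\<exists>h. embeds V E H h) \<or>
      (\<exists>X' Y' F K. finite X' \<and> finite Y' \<and> s \<le> card X' \<and> s \<le> card Y' \<and>
         layered d H (Suc n) X' Y' F K \<and> F 1 \<noteq> {})"
      using S H h by blast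
    then show "\<exists>h. embeds V E H h"
    proof (elim disjE exE conjE)
      fix X1 Y1 F K assume X1: "finite X1" "finite Y1" "s \<le> card X1" "s \<le> card Y1"
        and "layered d H (Suc n) X1 Y1 F K" and F1: "F 1 \<noteq> {}"
      then have lay: "layered d H d X1 Y1 F K" using n by simp
      define \<Phi> where "\<Phi> = (\<Union>i\<le>d. F i)"
      have fF: "finite (F i)" "card (F i) \<le> d ^ d" if "i \<le> d" for i
      proof -
        have "card (F i) \<le> d ^ i" using lay that by (simp add: layered_def)
        also have "\<dots> \<le> d ^ d" using that d by (intro power_increasing) auto
        finally show "card (F i) \<le> d ^ d" .
        show "finite (F i)" using lay that by (simp add: layered_def)
      qed
      have f\<Phi>: "finite \<Phi>" using fF by (simp add: \<Phi>_def)
      have "card \<Phi> \<le> (\<Sum>i\<le>d. d ^ d)"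
        unfolding \<Phi>_def using fF by (intro order_trans[OF card_UN_le] sum_mono) auto
      then have c\<Phi>: "card \<Phi> \<le> f" by (simp add: f_def)
      have K: "finite K" "card K \<le> k" using lay by (simp_all add: layered_def k_def)
      have inj: "inj_on \<phi> X1" if "\<phi> \<in> \<Phi>" for \<phi>
        using lay that unfolding layered_def \<Phi>_def by blast
      define B where "B = (\<Union>\<phi>\<in>\<Phi>. \<phi> -` K \<inter> X1)"
      have fB: "finite B" unfolding B_def using f\<Phi> X1(1) by auto
      have "card B \<le> (\<Sum>\<phi>\<in>\<Phi>. k)"
        unfolding B_def using f\<Phi> inj K card_vimage_inj_on_le[of _ X1 K]
        by (intro order_trans[OF card_UN_le] sum_mono) (auto intro: le_trans)
      also have "\<dots> \<le> f * k" using c\<Phi> by simp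
      finally have cB: "card B \<le> f * k" .
      have "N \<le> card X1 - card B" using X1(3) cB unfolding s_def by linarith
      then have "N \<le> card (X1 - B)" using diff_card_le_card_Diff[OF fB, of X1] by linarith
      moreover have "card \<Phi> * card \<Phi> \<le> f * f" using c\<Phi> by (intro mult_le_mono)
      then have "2 * card V * (card \<Phi> * card \<Phi> + 1) \<le> N"
        unfolding N_def by (intro mult_le_mono) auto
      ultimately have "2 * card V * (card \<Phi> * card \<Phi> + 1) \<le> card (X1 - B)" by linarith
      moreover have "\<forall>\<phi>\<in>\<Phi>. inj_on \<phi> (X1 - B)" using inj by (meson Diff_subset inj_on_subset)
      ultimately obtain X2 where X2: "X2 \<subseteq> X1 - B" "card X2 = 2 * card V"
        "\<forall>\<phi>\<in>\<Phi>. \<forall>\<psi>\<in>\<Phi>. \<forall>x\<in>X2. \<forall>y\<in>X2. x \<noteq> y \<longrightarrow> \<phi> x \<noteq> \<psi> y"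
        using separate_functions[OF _ f\<Phi>, of "X1 - B" "2 * card V"] X1(1) by blast
      have "X2 \<subseteq> X1" using X2(1) by blast
      have lay2: "layered d H d X2 Y1 F K" using lay \<open>X2 \<subseteq> X1\<close> order_refl by (rule layered_mono)
      have memb: "\<phi> \<in> \<Phi>" if "i \<le> d" "\<phi> \<in> F i" for i \<phi> using that by (auto simp: \<Phi>_def)
      show ?thesis
      proof (rule layered_embeds[OF H(1) tr ind r _ d lay2 F1])
        show "weight I V E \<le> d" using w by simp
        show "\<phi> x \<noteq> \<psi> y" if "i \<le> d" "j \<le> d" "\<phi> \<in> F i" "\<psi> \<in> F j" "x \<in> X2" "y \<in> X2" "x \<noteq> y"
          for i j \<phi> \<psi> x y
          using X2(3) memb[OF that(1,3)] memb[OF that(2,4)] that(5-7) by blast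
        show "\<phi> x \<notin> K" if "i \<le> d" "\<phi> \<in> F i" "x \<in> X2" for i \<phi> x
        proof
          assume "\<phi> x \<in> K"
          then have "x \<in> B" using memb[OF that(1,2)] that(3) \<open>X2 \<subseteq> X1\<close> by (auto simp: B_def)
          then show False using that(3) X2(1) by blast
        qed
        show "2 * card V \<le> card X2" using X2(2) by simp
        have "2 * card V * 1 \<le> N" unfolding N_def by (intro mult_le_mono2) simp
        then show "2 * card V \<le> card Y1" using X1(4) unfolding s_def by linarith
      qed
    qed blast
  qed
qed

section \<open>Density\<close>

definition shadow :: "'b set set \<Rightarrow> 'b set set" where
  "shadow H = {p. card p = 2 \<and> (\<exists>t\<in>H. p \<subseteq> t)}"

lemma shadow_colink:
  assumes "triple_system H"
  shows "a \<noteq> b \<Longrightarrow> {a, b} \<in> shadow H \<longleftrightarrow> colink H a b \<noteq> {}"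
    "a \<noteq> b \<Longrightarrow> t \<in> H \<Longrightarrow> {a, b} \<subseteq> t \<Longrightarrow> \<exists>c. t = {a, b, c}"
proof -
  show 1: "\<exists>c. t = {a, b, c}" if "a \<noteq> b" "t \<in> H" "{a, b} \<subseteq> t" for t
  proof -
    have "card t = 3" using assms that(2) by (simp add: triple_system_def)
    then have "card (t - {a, b}) = 1" using that by (simp add: card_Diff_subset)
    then obtain c where "t - {a, b} = {c}" by (auto simp: card_1_singleton_iff)
    then have "t = {a, b, c}" using that(3) by blast
    then show ?thesis ..
  qed
  assume ab: "a \<noteq> b"
  show "{a, b} \<in> shadow H \<longleftrightarrow> colink H a b \<noteq> {}"
  proof
    assume "{a, b} \<in> shadow H"
    then obtain t where "t \<in> H" "{a, b} \<subseteq> t" by (auto simp: shadow_def)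
    with 1[OF ab this] show "colink H a b \<noteq> {}" by (auto simp: colink_def)
  next
    assume "colink H a b \<noteq> {}"
    then obtain c where "{a, b, c} \<in> H" by (auto simp: colink_def)
    moreover have "{a, b} \<subseteq> {a, b, c}" by blast
    ultimately show "{a, b} \<in> shadow H" using ab unfolding shadow_def by auto
  qed
qed

lemma triple_system_subset: "triple_system H \<Longrightarrow> H' \<subseteq> H \<Longrightarrow> triple_system H'"
  by (auto simp: triple_system_def intro: finite_subset)

lemma finite_shadow:
  assumes "triple_system H"
  shows "finite (shadow H)"
proof (rule finite_subset)
  show "shadow H \<subseteq> Pow (\<Union>H)" by (auto simp: shadow_def)
  have "finite t" if "t \<in> H" for t
    using assms that by (intro card_ge_0_finite) (auto simp: triple_system_def)
  then show "finite (Pow (\<Union>H))" using assms by (auto simp: triple_system_def)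
qed

text \<open>Repeatedly delete all triples through a pair of codegree between 1 and \<open>k\<close>.
  The pair leaves the shadow for good, so each pair of the shadow is charged at most
  \<open>k\<close> triples.\<close>

lemma full_subsystem:
  assumes "triple_system H"
  shows "\<exists>H1\<subseteq>H. full (Suc k) H1 \<and> card H \<le> card H1 + k * card (shadow H)"
  using assms
proof (induction "card H" arbitrary: H rule: less_induct)
  case less
  show ?case
  proof (cases "full (Suc k) H")
    case True
    then show ?thesis by (intro exI[of _ H]) simp
  next
    case False
    then obtain a b where ab: "colink H a b \<noteq> {}" "card (colink H a b) \<le> k"
      by (auto simp: full_def not_le less_Suc_eq_le)
    then obtain c where c: "{a, b, c} \<in> H" by (auto simp: colink_def)
    have ne: "a \<noteq> b" using triple_distinct(1)[OF less.prems c] .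
    have fH: "finite H" using less.prems by (simp add: triple_system_def)
    define D where "D = {t \<in> H. {a, b} \<subseteq> t}"
    have fD: "finite D" "D \<subseteq> H" using fH by (auto simp: D_def)
    have "D \<subseteq> (\<lambda>c. {a, b, c}) ` colink H a b"
    proof
      fix t assume "t \<in> D"
      then have t: "t \<in> H" "{a, b} \<subseteq> t" by (auto simp: D_def)
      with shadow_colink(2)[OF less.prems ne] obtain c where "t = {a, b, c}" by blast
      with t(1) show "t \<in> (\<lambda>c. {a, b, c}) ` colink H a b" by (auto simp: colink_def)
    qed
    then have "card D \<le> card (colink H a b)"
      using finite_colink[OF less.prems] by (meson surj_card_le)
    then have cD: "card D \<le> k" using ab(2) by linarith
    have "{a, b, c} \<in> D" using c by (auto simp: D_def)
    then have lt: "H - D \<subset> H" using fD by blast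
    have "triple_system (H - D)" using less.prems by (rule triple_system_subset) blast
    with less.hyps[OF psubset_card_mono[OF fH lt]] obtain H1 where
      H1: "H1 \<subseteq> H - D" "full (Suc k) H1" "card (H - D) \<le> card H1 + k * card (shadow (H - D))"
      by blast
    have p: "{a, b} \<in> shadow H" using shadow_colink(1)[OF less.prems ne] ab(1) by simp
    have "shadow (H - D) \<subseteq> shadow H - {{a, b}}" by (auto simp: shadow_def D_def)
    then have "card (shadow (H - D)) \<le> card (shadow H - {{a, b}})"
      using finite_shadow[OF less.prems] by (intro card_mono) auto
    also have "\<dots> = card (shadow H) - 1" using p by (rule card_Diff_singleton)
    finally have "card (shadow (H - D)) + 1 \<le> card (shadow H)"
      using p finite_shadow[OF less.prems] by (metis Suc_eq_plus1 Suc_leI card_gt_0_iff empty_iff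
          le_imp_less_Suc Suc_pred')
    then have "k * (card (shadow (H - D)) + 1) \<le> k * card (shadow H)" by (rule mult_le_mono2)
    moreover have "card H = card (H - D) + card D"
      using card_Diff_subset[OF fD] card_mono[OF fH fD(2)] by simp
    ultimately have "card H \<le> card H1 + k * card (shadow H)" using H1(3) cD by simp
    with H1(1,2) show ?thesis by blast
  qed
qed

text \<open>A nonempty full subsystem would contain a copy by \<open>full_embeds\<close>, so the
  deletion in \<open>full_subsystem\<close> has to consume all of \<open>H\<close>.\<close>

lemma card_le_shadow:
  assumes H: "triple_system H" and tr: "rooted r V E" and "\<nexists>h. embeds V E H h"
  shows "card H \<le> 2 * card V * card (shadow H)"
proof -
  obtain H1 where H1: "H1 \<subseteq> H" "full (Suc (2 * card V)) H1"
    "card H \<le> card H1 + 2 * card V * card (shadow H)"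
    using full_subsystem[OF H] by blast
  have "H1 = {}"
  proof (rule ccontr)
    assume "H1 \<noteq> {}"
    from full_embeds[OF triple_system_subset[OF H H1(1)] H1(2) this tr]
    obtain h where "embeds V E H1 h" by auto
    then have "embeds V E H h" using H1(1) by (auto simp: embeds_def)
    with assms(3) show False by blast
  qed
  with H1(3) show ?thesis by simp
qed

section \<open>Grids in dense relations, and graphs with small books\<close>

text \<open>The Kovari-Sos-Turan argument: take \<open>a\<close> rows of large degree. On average a
  column meets at least \<open>s + 1\<close> of them, so linearly many columns meet at least
  \<open>s\<close>, and by pigeonhole many of these share the same \<open>s\<close> rows.\<close>

lemma dense_relation_grid:
  fixes \<delta> :: real
  assumes "\<delta> > 0"
  shows "\<exists>n0. \<forall>n\<ge>n0. \<forall>P\<subseteq>{..<n::nat} \<times> {..<n}. \<delta> * real n ^ 2 \<le> real (card P) \<longrightarrow>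
    (\<exists>X Y. finite X \<and> finite Y \<and> s \<le> card X \<and> s \<le> card Y \<and> X \<times> Y \<subseteq> P)"
proof -
  define a where "a = nat \<lceil>real (s + 1) * 2 / \<delta>\<rceil>"
  have a: "real (s + 1) \<le> real a * (\<delta> / 2)"
  proof -
    have "real (s + 1) * 2 / \<delta> \<le> real a" unfolding a_def by linarith
    then show ?thesis using assms by (simp add: field_simps)
  qed
  define n0 where "n0 = nat \<lceil>2 * real a / \<delta>\<rceil> + a * (2 ^ a * s) + 1"
  show ?thesis
  proof (intro exI[of _ n0] allI impI)
    fix n P assume n: "n0 \<le> n" and P: "P \<subseteq> {..<n} \<times> {..<n}"
      and dense: "\<delta> * real n ^ 2 \<le> real (card P)"
    have npos: "n > 0" using n by (simp add: n0_def)
    define N where "N x = {y. (x, y) \<in> P}" for x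
    have Nsub: "N x \<subseteq> {..<n}" for x using P by (auto simp: N_def)
    have fN: "finite (N x)" "card (N x) \<le> n" for x
      using finite_subset[OF Nsub] card_mono[OF _ Nsub] by auto
    define A where "A = {x \<in> {..<n}. \<delta> / 2 * real n \<le> real (card (N x))}"
    have "P = (SIGMA x:{..<n}. N x)" using P by (auto simp: N_def)
    then have "card P = (\<Sum>x<n. card (N x))" using fN by simp
    then have "real (card P) = (\<Sum>x<n. real (card (N x)))" by simp
    also have "\<dots> \<le> (\<Sum>x<n. (if x \<in> A then real n else 0) + \<delta> / 2 * real n)"
    proof (rule sum_mono)
      fix x assume "x \<in> {..<n}"
      then show "real (card (N x)) \<le> (if x \<in> A then real n else 0) + \<delta> / 2 * real n"
        using fN(2)[of x] assms by (auto simp: A_def intro: add_increasing2)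
    qed
    also have "\<dots> = (\<Sum>x<n. if x \<in> A then real n else 0) + real n * (\<delta> / 2 * real n)"
      by (simp add: sum.distrib)
    also have "(\<Sum>x<n. if x \<in> A then real n else 0) = real (card A) * real n"
    proof -
      have "{..<n} \<inter> A = A" by (auto simp: A_def)
      then show ?thesis by (simp add: sum.If_cases)
    qed
    finally have "\<delta> * real n ^ 2 \<le> real (card A) * real n + real n * (\<delta> / 2 * real n)"
      using dense by linarith
    then have "real n * (\<delta> / 2 * real n) \<le> real n * real (card A)"
      by (simp add: power2_eq_square algebra_simps)
    then have cA: "\<delta> / 2 * real n \<le> real (card A)" using npos by (simp only: mult_le_cancel_left_pos of_nat_0_less_iff)
    have "2 * real a / \<delta> \<le> real n" using n unfolding n0_def by linarith
    then have "real a \<le> \<delta> / 2 * real n" using assms by (simp add: field_simps)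
    then have "a \<le> card A" using cA by linarith
    then obtain A' where A': "A' \<subseteq> A" "card A' = a" "finite A'"
      by (rule obtain_subset_with_card_n)
    define M where "M y = {x \<in> A'. (x, y) \<in> P}" for y
    define G where "G = {y \<in> {..<n}. s \<le> card (M y)}"
    have cM: "card (M y) \<le> a" for y
      using card_mono[OF A'(3), of "M y"] A'(2) by (auto simp: M_def)
    have "(\<Sum>x\<in>A'. card (N x)) = card (SIGMA x:A'. N x)" using fN A'(3) by simp
    also have "\<dots> = card (prod.swap ` (SIGMA x:A'. N x))"
      by (rule card_image[symmetric]) simp
    also have "prod.swap ` (SIGMA x:A'. N x) = (SIGMA y:{..<n}. M y)"
      using P by (auto simp: N_def M_def image_iff)
    also have "card \<dots> = (\<Sum>y<n. card (M y))" using A'(3) by (simp add: M_def)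
    finally have dc: "(\<Sum>x\<in>A'. card (N x)) = (\<Sum>y<n. card (M y))" .
    have "real (s + 1) * real n \<le> real a * (\<delta> / 2) * real n"
      using a by (intro mult_right_mono) auto
    also have "\<dots> = (\<Sum>x\<in>A'. \<delta> / 2 * real n)" using A'(2) by simp
    also have "\<dots> \<le> (\<Sum>x\<in>A'. real (card (N x)))"
      using A'(1) by (intro sum_mono) (auto simp: A_def)
    also have "\<dots> = real (\<Sum>y<n. card (M y))" using dc by (metis of_nat_sum)
    finally have "real ((s + 1) * n) \<le> real (\<Sum>y<n. card (M y))"
      by (simp only: of_nat_mult)
    then have "(s + 1) * n \<le> (\<Sum>y<n. card (M y))" by (simp only: of_nat_le_iff)
    also have "\<dots> \<le> (\<Sum>y<n. (if y \<in> G then a else 0) + s)"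
    proof (rule sum_mono)
      fix y assume "y \<in> {..<n}"
      then show "card (M y) \<le> (if y \<in> G then a else 0) + s"
        using cM[of y] by (auto simp: G_def)
    qed
    also have "\<dots> = (\<Sum>y<n. if y \<in> G then a else 0) + n * s" by (simp add: sum.distrib)
    also have "(\<Sum>y<n. if y \<in> G then a else 0) = card G * a"
    proof -
      have "{..<n} \<inter> G = G" by (auto simp: G_def)
      then show ?thesis by (simp add: sum.If_cases)
    qed
    finally have nG: "n \<le> card G * a" by simp
    have "\<forall>y\<in>G. \<exists>T\<subseteq>M y. card T = s"
    proof
      fix y assume "y \<in> G"
      then have "s \<le> card (M y)" by (simp add: G_def)
      then show "\<exists>T\<subseteq>M y. card T = s" by (metis obtain_subset_with_card_n)
    qed
    then obtain T where T: "\<And>y. y \<in> G \<Longrightarrow> T y \<subseteq> M y \<and> card (T y) = s" by metis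
    have fG: "finite G" by (simp add: G_def)
    have TA: "T ` G \<subseteq> Pow A'" using T by (auto simp: M_def)
    have "\<exists>t\<in>T ` G. s \<le> card {y \<in> G. T y = t}"
    proof (rule ccontr)
      assume *: "\<not> ?thesis"
      have "card G = (\<Sum>t\<in>T ` G. card {y \<in> G. T y = t})"
        using card_eq_sum sum.image_gen[OF fG, of "\<lambda>_. 1::nat" T] by simp
      also have "\<dots> \<le> (\<Sum>t\<in>T ` G. s)" using * by (intro sum_mono) (auto simp: not_le)
      also have "\<dots> = card (T ` G) * s" by simp
      also have "\<dots> \<le> 2 ^ a * s"
        using card_mono[OF _ TA] A'(2,3) by (intro mult_le_mono1) (simp add: card_Pow)
      finally have "card G * a \<le> 2 ^ a * s * a" by (rule mult_le_mono1)
      then have "n \<le> a * (2 ^ a * s)" using nG by (simp only: mult.commute)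
      then show False using n unfolding n0_def by linarith
    qed
    then obtain y0 where y0: "y0 \<in> G" "s \<le> card {y \<in> G. T y = T y0}" by auto
    have "T y0 \<times> {y \<in> G. T y = T y0} \<subseteq> P"
    proof (intro subsetI)
      fix p assume "p \<in> T y0 \<times> {y \<in> G. T y = T y0}"
      then obtain x y where p: "p = (x, y)" "y \<in> G" "x \<in> T y" by auto
      then show "p \<in> P" using T[OF p(2)] by (auto simp: M_def)
    qed
    moreover have "finite (T y0)" using TA y0(1) A'(3) by (meson PowD finite_subset imageI subsetD)
    ultimately show "\<exists>X Y. finite X \<and> finite Y \<and> s \<le> card X \<and> s \<le> card Y \<and> X \<times> Y \<subseteq> P"
      using T[OF y0(1)] y0(2) fG
      by (intro exI[of _ "T y0"] exI[of _ "{y \<in> G. T y = T y0}"]) auto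
  qed
qed

text \<open>Mantel's theorem with slack: adjacent vertices have degree sum at most
  \<open>n + k\<close>. Summing this over the edges and applying the Cauchy-Schwarz inequality to
  the degrees gives the bound.\<close>

lemma card_book_free:
  assumes L: "\<And>p. p \<in> L \<Longrightarrow> p \<subseteq> {..<n::nat} \<and> card p = 2"
    and book: "\<And>u v. {u, v} \<in> L \<Longrightarrow> card {w. {u, w} \<in> L \<and> {v, w} \<in> L} \<le> k"
  shows "4 * card L \<le> n * (n + k)"
proof -
  define N where "N u = {v. {u, v} \<in> L}" for u
  have Nsub: "N u \<subseteq> {..<n}" for u using L by (fastforce simp: N_def)
  have fN: "finite (N u)" for u using finite_subset[OF Nsub] by simp
  \<comment> \<open>Ordered pairs, so that every edge occurs twice and summing \<open>d u\<close>
    over \<open>P\<close> yields the sum of the squared degrees.\<close>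
  define P where "P = (SIGMA u:{..<n}. N u)"
  have fP: "finite P" using fN by (simp add: P_def)
  have Pmem: "(u, v) \<in> P \<longleftrightarrow> {u, v} \<in> L" for u v
    using L[of "{u, v}"] by (auto simp: P_def N_def)
  have fL: "finite L" by (rule finite_subset[of _ "Pow {..<n}"]) (use L in auto)
  have "2 * card L \<le> card P"
  proof -
    have "(\<lambda>(u, v). {u, v}) ` P \<subseteq> L" using Pmem by auto
    have ge: "2 \<le> card {q \<in> P. (\<lambda>(u, v). {u, v}) q = p}" if "p \<in> L" for p
    proof -
      have "card p = 2" using L \<open>p \<in> L\<close> by blast
      then obtain u v where p: "p = {u, v}" "u \<noteq> v" by (auto simp: card_2_iff)
      then have "{(u, v), (v, u)} \<subseteq> {q \<in> P. (\<lambda>(u, v). {u, v}) q = p}"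
        using \<open>p \<in> L\<close> by (auto simp: Pmem insert_commute)
      then have "card {(u, v), (v, u)} \<le> card {q \<in> P. (\<lambda>(u, v). {u, v}) q = p}"
        using fP by (intro card_mono) auto
      then show ?thesis using p(2) by simp
    qed
    have "2 * card L = (\<Sum>p\<in>L. 2)" by simp
    also have "\<dots> \<le> (\<Sum>p\<in>L. card {q \<in> P. (\<lambda>(u, v). {u, v}) q = p})"
      using ge by (rule sum_mono)
    also have "\<dots> = card (\<Union>p\<in>L. {q \<in> P. (\<lambda>(u, v). {u, v}) q = p})"
      using fL fP by (intro card_UN_disjoint[symmetric]) auto
    also have "\<dots> \<le> card P" using fP by (intro card_mono) auto
    finally show ?thesis .
  qed
  define d where "d u = real (card (N u))" for u
  define S where "S = (\<Sum>u<n. d u)"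
  define Q where "Q = (\<Sum>u<n. (d u)\<^sup>2)"
  have S: "S = real (card P)" using fN by (simp add: S_def d_def P_def)
  have fst: "(\<Sum>(u, v)\<in>P. d u) = Q"
  proof -
    have "(\<Sum>(u, v)\<in>P. d u) = (\<Sum>u<n. \<Sum>v\<in>N u. d u)"
      unfolding P_def using fN by (intro sum.Sigma[symmetric]) auto
    then show ?thesis by (simp add: Q_def d_def power2_eq_square)
  qed
  have "(v, u) \<in> P" if "(u, v) \<in> P" for u v
    using that by (simp add: Pmem insert_commute)
  then have snd: "(\<Sum>(u, v)\<in>P. d v) = (\<Sum>(u, v)\<in>P. d u)"
    by (intro sum.reindex_bij_witness[of _ prod.swap prod.swap]) auto
  have le: "d u + d v \<le> real (n + k)" if "(u, v) \<in> P" for u v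
  proof -
    have "card (N u) + card (N v) = card (N u \<union> N v) + card (N u \<inter> N v)"
      by (rule card_Un_Int[OF fN fN])
    moreover have "card (N u \<union> N v) \<le> card {..<n}"
      using Nsub by (intro card_mono) auto
    moreover have "N u \<inter> N v = {w. {u, w} \<in> L \<and> {v, w} \<in> L}" by (auto simp: N_def)
    moreover have "{u, v} \<in> L" using that by (simp add: Pmem)
    ultimately have "card (N u) + card (N v) \<le> n + k" using book[of u v] by simp
    then show ?thesis unfolding d_def by linarith
  qed
  have "2 * Q = (\<Sum>(u, v)\<in>P. d u + d v)"
    using fst snd by (simp add: sum.distrib split_def)
  also have "\<dots> \<le> (\<Sum>(u, v)\<in>P. real (n + k))"
    using le by (intro sum_mono) auto
  also have "\<dots> = S * real (n + k)" by (simp add: S split_def)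
  finally have Q: "2 * Q \<le> S * real (n + k)" .
  \<comment> \<open>The Cauchy-Schwarz inequality \<open>S * S \<le> n * Q\<close>, obtained as
    nonnegativity of a variance.\<close>
  have "0 \<le> (\<Sum>u<n. (real n * d u - S)\<^sup>2)" by (intro sum_nonneg) simp
  also have "\<dots> = (\<Sum>u<n. real n * real n * (d u)\<^sup>2 - 2 * real n * S * d u + S * S)"
    by (intro sum.cong refl) (simp add: power2_eq_square algebra_simps)
  also have "\<dots> = real n * real n * Q - 2 * real n * S * S + real n * (S * S)"
    by (simp add: sum.distrib sum_subtractf sum_distrib_left Q_def S_def)
  also have "\<dots> = real n * (real n * Q - S * S)" by (simp add: algebra_simps)
  finally have "0 \<le> real n * (real n * Q - S * S)" .
  have "2 * S \<le> real n * real (n + k)"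
  proof (cases "S = 0")
    case False
    then have Spos: "S > 0" by (simp add: S)
    then have "n > 0" by (auto simp: S_def intro: ccontr)
    with \<open>0 \<le> real n * (real n * Q - S * S)\<close> have "S * S \<le> real n * Q"
      by (simp add: zero_le_mult_iff)
    then have "2 * (S * S) \<le> real n * (2 * Q)" by simp
    also have "\<dots> \<le> real n * (S * real (n + k))" using Q by (intro mult_left_mono) auto
    finally have "S * (2 * S) \<le> S * (real n * real (n + k))" by (simp add: algebra_simps)
    then show ?thesis using Spos by (simp only: mult_le_cancel_left_pos)
  qed simp
  then have "real (2 * card P) \<le> real (n * (n + k))" unfolding S by simp
  then have "2 * card P \<le> n * (n + k)" by (simp only: of_nat_le_iff)
  with \<open>2 * card L \<le> card P\<close> show ?thesis by linarith
qed

section \<open>Upper bound\<close>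

text \<open>Used to see that every vertex of a copy lies in one of its triples, hence in the host
  vertex set.\<close>

lemma rooted_covers: "rooted r V E \<Longrightarrow> E \<noteq> {} \<Longrightarrow> V = \<Union>E"
proof (induction rule: rooted.induct)
  case (leaf V E u v)
  show ?case
  proof (cases "E = {}")
    case True
    then have "card V = 1" using rooted_graph(5)[OF leaf.hyps(1)] by simp
    then have "V = {u}" using leaf.hyps(2) by (auto simp: card_1_singleton_iff)
    then show ?thesis using True by auto
  next
    case False
    then show ?thesis using leaf by auto
  qed
qed simp

lemma embeds_contains_copy:
  assumes h: "embeds V E H h" "H \<subseteq> triangles W G" and tr: "rooted r V E" "E \<noteq> {}"
  shows "contains_copy (tri_blowup_V V E) (tri_blowup_E V E) W G"
  unfolding contains_copy_def
proof (intro exI[of _ h] conjI ballI)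
  have gr: "graph V E" and cov: "V = \<Union>E" using rooted_graph[OF tr(1)] rooted_covers[OF tr] by auto
  show inj: "inj_on h (tri_blowup_V V E)" using h(1) by (simp add: embeds_def)
  have tri: "h ` insert (Inr e) (Inl ` e) \<in> triangles W G" if "e \<in> E" for e
    using h that by (auto simp: embeds_def)
  show "h ` tri_blowup_V V E \<subseteq> W"
  proof
    fix b assume "b \<in> h ` tri_blowup_V V E"
    then obtain e where "e \<in> E" "b \<in> h ` insert (Inr e) (Inl ` e)"
      using cov unfolding tri_blowup_V_def by blast
    moreover have "h ` insert (Inr e) (Inl ` e) \<subseteq> W"
      using tri[OF \<open>e \<in> E\<close>] unfolding triangles_def by blast
    ultimately show "b \<in> W" by blast
  qed
  fix e' assume "e' \<in> tri_blowup_E V E"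
  then obtain e where e: "e \<in> E" "e' = Inl ` e \<or> (\<exists>x\<in>e. e' = {Inl x, Inr e})"
    by (auto simp: tri_blowup_E_def)
  have pair: "h ` {z, z'} \<in> G" if z: "z \<in> insert (Inr e) (Inl ` e)" "z' \<in> insert (Inr e) (Inl ` e)" "z \<noteq> z'"
    for z z'
  proof -
    have "insert (Inr e) (Inl ` e) \<subseteq> tri_blowup_V V E"
      using e(1) gr by (auto simp: tri_blowup_V_def graph_def)
    then have "h z \<noteq> h z'" using inj z by (meson inj_onD subsetD)
    moreover have "h z \<in> h ` insert (Inr e) (Inl ` e)" "h z' \<in> h ` insert (Inr e) (Inl ` e)"
      using z(1,2) by blast+
    ultimately have "{h z, h z'} \<in> G" using tri[OF e(1)] unfolding triangles_def by blast
    then show ?thesis by simp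
  qed
  from e(1) gr obtain u v where uv: "e = {u, v}" "u \<noteq> v" by (auto simp: graph_def card_2_iff)
  from e(2) show "h ` e' \<in> G"
  proof
    assume "e' = Inl ` e"
    then show ?thesis using pair[of "Inl u" "Inl v"] uv by simp
  next
    assume "\<exists>x\<in>e. e' = {Inl x, Inr e}"
    then obtain x where "x \<in> e" "e' = {Inl x, Inr e}" by blast
    then show ?thesis using pair[of "Inl x" "Inr e"] by simp
  qed
qed

lemma triangles_triple_system:
  assumes "finite W"
  shows "triple_system (triangles W G)"
proof -
  have "triangles W G \<subseteq> Pow W" by (auto simp: triangles_def)
  then have "finite (triangles W G)" using assms by (meson finite_Pow_iff finite_subset)
  then show ?thesis by (auto simp: triple_system_def triangles_def)
qed

lemma card_pairs_le:
  assumes "\<And>p. p \<in> L \<Longrightarrow> p \<subseteq> {..<n::nat} \<and> card p = 2"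
  shows "finite L" "card L \<le> card {(u, v). u < n \<and> v < n \<and> {u, v} \<in> L}" "card L \<le> n * n"
proof -
  let ?P = "{(u, v). u < n \<and> v < n \<and> {u, v} \<in> L}"
  have P: "?P \<subseteq> {..<n} \<times> {..<n}" by auto
  then have fP: "finite ?P" by (rule finite_subset) simp
  have sub: "L \<subseteq> (\<lambda>(u, v). {u, v}) ` ?P"
  proof
    fix p assume p: "p \<in> L"
    then have "card p = 2" "p \<subseteq> {..<n}" using assms by blast+
    then obtain u v where "p = {u, v}" "u < n" "v < n" by (auto simp: card_2_iff)
    then show "p \<in> (\<lambda>(u, v). {u, v}) ` ?P" using p by (intro image_eqI[of _ _ "(u, v)"]) auto
  qed
  then show "finite L" using fP by (meson finite_imageI finite_subset)
  show le: "card L \<le> card ?P" using surj_card_le[OF fP sub] .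
  have "card ?P \<le> card ({..<n} \<times> {..<n})" using P by (intro card_mono) auto
  with le show "card L \<le> n * n" by simp
qed

text \<open>Pairs of codegree above \<open>k\<close> are few by double counting, since
  \<open>H\<close> has at most \<open>D * n * n\<close> triples. The remaining pairs satisfy
  \<open>card_book_free\<close>: as \<open>H\<close> contains all triangles of \<open>G\<close>, any
  triangle formed by such pairs is counted in their codegrees.\<close>

lemma card_shadow_triangles:
  fixes G :: "nat set set" and n :: nat
  defines "H \<equiv> triangles {..<n} G"
  assumes H: "card H \<le> D * card (shadow H)" and k: "k > 0"
  shows "real (card (shadow H)) \<le> real n ^ 2 / 4 + 8 * real D * real n ^ 2 / real k + real k * real n / 4"
proof -
  have ts: "triple_system H" unfolding H_def by (rule triangles_triple_system) simp
  have fH: "finite H" using ts by (simp add: triple_system_def)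
  have sh: "p \<subseteq> {..<n} \<and> card p = 2" if "p \<in> shadow H" for p
    using that by (auto simp: shadow_def H_def triangles_def)
  have edge: "{a, b} \<in> G" if "{a, b} \<in> shadow H" for a b
  proof -
    have "a \<noteq> b" using sh[OF that] by auto
    with that show ?thesis by (auto simp: shadow_def H_def triangles_def)
  qed
  define codeg where "codeg p = card {t \<in> H. p \<subseteq> t}" for p
  define Hv where "Hv = {p \<in> shadow H. k < codeg p}"
  define Lt where "Lt = {p \<in> shadow H. codeg p \<le> k}"
  have fS: "finite (shadow H)" using card_pairs_le(1)[OF sh] .
  have "card (shadow H) \<le> n * n" using card_pairs_le(3)[OF sh] .
  then have "card H \<le> D * (n * n)" using H by (meson le_trans mult_le_mono2)
  moreover have "k * card Hv \<le> 8 * card H"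
  proof -
    have fHv: "finite Hv" using fS by (simp add: Hv_def)
    have "k * card Hv = (\<Sum>p\<in>Hv. k)" by simp
    also have "\<dots> \<le> (\<Sum>p\<in>Hv. codeg p)" by (intro sum_mono) (auto simp: Hv_def)
    also have "\<dots> = card (SIGMA p:Hv. {t \<in> H. p \<subseteq> t})" using fHv fH by (simp add: codeg_def)
    \<comment> \<open>A triple has 8 subsets, which is a sufficient crude bound for the number of
      its pairs.\<close>
    also have "\<dots> \<le> card (SIGMA t:H. Pow t)"
    proof (rule card_inj_on_le[of prod.swap])
      have "finite t" if "t \<in> H" for t
        using ts that by (intro card_ge_0_finite) (auto simp: triple_system_def)
      then show "finite (SIGMA t:H. Pow t)" using fH by (intro finite_SigmaI) auto
    qed auto
    also have "\<dots> = (\<Sum>t\<in>H. card (Pow t))"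
    proof (rule card_SigmaI[OF fH], rule ballI)
      fix t assume "t \<in> H"
      then have "finite t" using ts by (intro card_ge_0_finite) (auto simp: triple_system_def)
      then show "finite (Pow t)" by simp
    qed
    also have "\<dots> = (\<Sum>t\<in>H. 8)"
    proof (rule sum.cong[OF refl])
      fix t assume "t \<in> H"
      then have "card t = 3" using ts by (simp add: triple_system_def)
      moreover from this have "finite t" by (intro card_ge_0_finite) simp
      ultimately show "card (Pow t) = 8" by (simp add: card_Pow)
    qed
    finally show ?thesis by simp
  qed
  ultimately have "k * card Hv \<le> 8 * (D * (n * n))" by linarith
  then have "real (k * card Hv) \<le> real (8 * (D * (n * n)))" by (simp only: of_nat_le_iff)
  then have hv: "real (card Hv) \<le> 8 * real D * real n ^ 2 / real k"
    using k by (simp add: field_simps power2_eq_square)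
  have "4 * card Lt \<le> n * (n + k)"
  proof (rule card_book_free)
    show "p \<subseteq> {..<n} \<and> card p = 2" if "p \<in> Lt" for p using sh that by (simp add: Lt_def)
    show "card {w. {u, w} \<in> Lt \<and> {v, w} \<in> Lt} \<le> k" if uv: "{u, v} \<in> Lt" for u v
    proof -
      have suv: "{u, v} \<in> shadow H" "codeg {u, v} \<le> k" using uv by (simp_all add: Lt_def)
      let ?W = "{w. {u, w} \<in> Lt \<and> {v, w} \<in> Lt}"
      have ne: "w \<noteq> u \<and> w \<noteq> v \<and> u \<noteq> v" if "w \<in> ?W" for w
      proof -
        have "card {u, w} = 2" "card {v, w} = 2" "card {u, v} = 2"
          using that sh suv(1) by (simp_all add: Lt_def)
        then show ?thesis by auto
      qed
      have "(\<lambda>w. {u, v, w}) ` ?W \<subseteq> {t \<in> H. {u, v} \<subseteq> t}"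
      proof (intro image_subsetI)
        fix w assume w: "w \<in> ?W"
        then have s: "{u, w} \<in> shadow H" "{v, w} \<in> shadow H" by (simp_all add: Lt_def)
        have "{u, w} \<subseteq> {..<n}" "{u, v} \<subseteq> {..<n}" using sh s(1) suv(1) by blast+
        moreover have "{u, w} \<in> G" "{v, w} \<in> G" "{u, v} \<in> G" using edge s suv(1) by blast+
        ultimately have "{u, v, w} \<in> H"
          using ne[OF w] unfolding H_def triangles_def by (auto simp: insert_commute)
        then show "{u, v, w} \<in> {t \<in> H. {u, v} \<subseteq> t}" by blast
      qed
      moreover have "inj_on (\<lambda>w. {u, v, w}) ?W"
      proof (rule inj_onI)
        fix w w' assume "w \<in> ?W" "w' \<in> ?W" "{u, v, w} = {u, v, w'}"
        then show "w = w'" using ne[of w] ne[of w'] by blast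
      qed
      ultimately have "card ?W \<le> codeg {u, v}"
        unfolding codeg_def using fH by (intro card_inj_on_le) auto
      then show ?thesis using suv(2) by linarith
    qed
  qed
  then have "real (4 * card Lt) \<le> real (n * (n + k))" by (simp only: of_nat_le_iff)
  then have lt: "real (card Lt) \<le> real n ^ 2 / 4 + real k * real n / 4"
    by (simp add: power2_eq_square algebra_simps)
  have "shadow H = Hv \<union> Lt" by (auto simp: Hv_def Lt_def)
  then have "card (shadow H) \<le> card Hv + card Lt" using card_Un_le by metis
  then have "real (card (shadow H)) \<le> real (card Hv) + real (card Lt)" by linarith
  with hv lt show ?thesis by linarith
qed

text \<open>The empty set has weight \<open>card E\<close>, and a single vertex on an edge does no
  worse, so an optimal set can be taken nonempty. This allows the tree to be rooted in it.\<close>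

lemma crosscut_props:
  assumes tr: "tree V E" and "E \<noteq> {}"
  shows "\<And>I. independent V E I \<Longrightarrow> crosscut V E \<le> weight I V E"
    "\<exists>I. I \<noteq> {} \<and> independent V E I \<and> crosscut V E = weight I V E"
proof -
  have fV: "finite V" and gr: "graph V E" using tr by (auto simp: tree_def)
  have fE: "finite E"
    by (rule finite_subset[of _ "Pow V"]) (use gr fV in \<open>auto simp: graph_def\<close>)
  have wt: "card I + card {e \<in> E. e \<inter> I = {}} = weight I V E" if "independent V E I" for I
  proof -
    have "V \<inter> I = I" using that by (auto simp: independent_def)
    then show ?thesis by (simp add: weight_def)
  qed
  let ?S = "{card I + card {e \<in> E. e \<inter> I = {}} | I. independent V E I}"
  have "?S \<subseteq> (\<lambda>I. card I + card {e \<in> E. e \<inter> I = {}}) ` Pow V" by (auto simp: independent_def)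
  then have fS: "finite ?S" using fV by (meson finite_Pow_iff finite_imageI finite_subset)
  show le: "crosscut V E \<le> weight I V E" if I: "independent V E I" for I
    unfolding crosscut_def wt[OF I, symmetric] using fS I by (intro Min_le) auto
  have "independent V E {}" by (simp add: independent_def)
  then have "?S \<noteq> {}" by blast
  with fS have "crosscut V E \<in> ?S" unfolding crosscut_def by (rule Min_in)
  then obtain I0 where I0: "independent V E I0" "crosscut V E = weight I0 V E" using wt by auto
  show "\<exists>I. I \<noteq> {} \<and> independent V E I \<and> crosscut V E = weight I V E"
  proof (cases "I0 = {}")
    case False then show ?thesis using I0 by blast
  next
    case True
    obtain e where e: "e \<in> E" using assms(2) by blast
    then obtain v where v: "v \<in> e" "v \<in> V" using gr by (fastforce simp: graph_def card_2_iff)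
    have "{v} \<notin> E"
    proof
      assume "{v} \<in> E"
      then have "card {v} = 2" using gr unfolding graph_def by blast
      then show False by simp
    qed
    then have ind: "independent V E {v}" using v(2) by (simp add: independent_def)
    have "{e \<in> E. e \<inter> {v} = {}} \<subseteq> E - {e}" using v(1) by blast
    then have "card {e \<in> E. e \<inter> {v} = {}} \<le> card (E - {e})" using fE by (intro card_mono) auto
    also have "\<dots> = card E - 1" using e by (rule card_Diff_singleton)
    finally have "card {e \<in> E. e \<inter> {v} = {}} \<le> card E - 1" .
    moreover have "card E > 0" using e fE by (auto simp: card_gt_0_iff)
    ultimately have "weight {v} V E \<le> weight I0 V E" using v(2) True by (simp add: weight_def)
    with le[OF ind] I0(2) have "crosscut V E = weight {v} V E" by linarith
    with ind show ?thesis by blast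
  qed
qed

text \<open>With \<open>t\<close> one below the crosscut number, cleaning costs at most
  \<open>t\<close> triples per shadow pair, and the shadow has at most about \<open>n^2 / 4\<close>
  pairs. A larger excess would survive as a full subsystem with dense shadow, and
  \<open>grid_embeds\<close> would find a copy there.\<close>

lemma triangles_upper_bound:
  fixes V :: "'a set" and \<epsilon> :: real
  assumes T: "tree V E" "E \<noteq> {}" and eps: "\<epsilon> > 0"
  shows "\<exists>n0. \<forall>n\<ge>n0. \<forall>G. \<not> contains_copy (tri_blowup_V V E) (tri_blowup_E V E) {..<n} G \<longrightarrow>
    real (card (triangles {..<n} G)) \<le> real (crosscut V E - 1) * real n ^ 2 / 4 + \<epsilon> * real n ^ 2"
proof -
  obtain I where I: "I \<noteq> {}" "independent V E I" "crosscut V E = weight I V E"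
    using crosscut_props(2)[OF T] by blast
  then obtain r where r: "r \<in> I" "r \<in> V" by (auto simp: independent_def)
  have tr: "rooted r V E" using tree_rooted[OF T(1) r(2)] .
  note g = rooted_graph[OF tr]
  have ind: "\<forall>e\<in>E. \<not> e \<subseteq> I"
  proof (intro ballI notI)
    fix e assume e: "e \<in> E" "e \<subseteq> I"
    then obtain u v where "e = {u, v}" using g(4) by (auto simp: graph_def card_2_iff)
    with e I(2) show False by (auto simp: independent_def)
  qed
  define t where "t = weight I V E - 1"
  have "card (V \<inter> I) > 0" using r g(2) by (auto simp: card_gt_0_iff)
  then have wt: "weight I V E = Suc t" by (simp add: t_def weight_def)
  define D where "D = 2 * card V"
  have D: "D > 0" using g(1,2) by (auto simp: D_def card_gt_0_iff)
  obtain S where S: "\<forall>(H :: nat set set) X Y. triple_system H \<longrightarrow> full (Suc t) H \<longrightarrow> finite X \<longrightarrow>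
      finite Y \<longrightarrow> S \<le> card X \<longrightarrow> S \<le> card Y \<longrightarrow> (\<forall>x\<in>X. \<forall>y\<in>Y. colink H x y \<noteq> {}) \<longrightarrow>
      (\<exists>h. embeds V E H h)"
    using grid_embeds[OF tr ind r(1) wt] by blast
  \<comment> \<open>By \<open>card_le_shadow\<close>, a subsystem with
    \<open>\<epsilon> / 2 * n^2\<close> triples has at least \<open>\<delta> * n^2\<close> shadow
    pairs.\<close>
  define \<delta> where "\<delta> = \<epsilon> / (2 * real D)"
  have del: "\<delta> > 0" using eps D by (simp add: \<delta>_def)
  obtain n1 where n1: "\<forall>n\<ge>n1. \<forall>P\<subseteq>{..<n::nat} \<times> {..<n}. \<delta> * real n ^ 2 \<le> real (card P) \<longrightarrow>
    (\<exists>X Y. finite X \<and> finite Y \<and> S \<le> card X \<and> S \<le> card Y \<and> X \<times> Y \<subseteq> P)"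
    using dense_relation_grid[OF del] by blast
  \<comment> \<open>This \<open>k\<close> keeps the contribution of heavy pairs, multiplied by
    \<open>t\<close>, below \<open>\<epsilon> / 4 * n^2\<close>; the choice of \<open>n0\<close>
    does the same for the linear term.\<close>
  define k where "k = nat \<lceil>32 * real D * real t / \<epsilon>\<rceil> + 1"
  have "32 * real D * real t / \<epsilon> \<le> real k" unfolding k_def by linarith
  then have k: "32 * real D * real t \<le> \<epsilon> * real k" "k > 0"
    using eps by (simp_all add: field_simps k_def)
  define n0 where "n0 = n1 + nat \<lceil>real t * real k / \<epsilon>\<rceil>"
  show ?thesis
  proof (intro exI[of _ n0] allI impI)
    fix n G assume n: "n0 \<le> n"
      and free: "\<not> contains_copy (tri_blowup_V V E) (tri_blowup_E V E) {..<n} G"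
    define H where "H = triangles {..<n} G"
    have H: "triple_system H" unfolding H_def by (rule triangles_triple_system) simp
    have none: "\<nexists>h. embeds V E H1 h" if "H1 \<subseteq> H" for H1
      using embeds_contains_copy[OF _ _ tr T(2)] free that unfolding H_def by blast
    have HD: "card H1 \<le> D * card (shadow H1)" if "H1 \<subseteq> H" for H1
      unfolding D_def using card_le_shadow[OF triple_system_subset[OF H that] tr none[OF that]] .
    have sh: "real (card (shadow H))
        \<le> real n ^ 2 / 4 + 8 * real D * real n ^ 2 / real k + real k * real n / 4"
      using card_shadow_triangles[of n G D k] HD[OF order_refl] k(2) by (simp add: H_def)
    have "real t * (8 * real D * real n ^ 2 / real k) \<le> \<epsilon> / 4 * real n ^ 2"
    proof -
      have "32 * real D * real t * real n ^ 2 \<le> \<epsilon> * real k * real n ^ 2"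
        using k(1) by (intro mult_right_mono) auto
      then show ?thesis using k(2) by (simp add: field_simps)
    qed
    moreover have "real t * (real k * real n / 4) \<le> \<epsilon> / 4 * real n ^ 2"
    proof -
      have "real t * real k / \<epsilon> \<le> real n" using n unfolding n0_def by linarith
      then have "real t * real k \<le> \<epsilon> * real n" using eps by (simp add: field_simps)
      then have "real t * real k * real n \<le> \<epsilon> * real n * real n" by (intro mult_right_mono) auto
      then show ?thesis by (simp add: power2_eq_square)
    qed
    moreover have "real t * real (card (shadow H)) \<le> real t * (real n ^ 2 / 4) +
        real t * (8 * real D * real n ^ 2 / real k) + real t * (real k * real n / 4)"
      using mult_left_mono[OF sh, of "real t"] by (simp add: distrib_left)
    ultimately have tsh: "real t * real (card (shadow H)) \<le> real t * (real n ^ 2 / 4) + \<epsilon> / 2 * real n ^ 2"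
      by linarith
    have "real (card H) \<le> real t * real n ^ 2 / 4 + \<epsilon> * real n ^ 2"
    proof (rule ccontr)
      assume big: "\<not> ?thesis"
      obtain H1 where H1: "H1 \<subseteq> H" "full (Suc t) H1" "card H \<le> card H1 + t * card (shadow H)"
        using full_subsystem[OF H] by blast
      have ts1: "triple_system H1" using H H1(1) by (rule triple_system_subset)
      from H1(3) have "real (card H) \<le> real (card H1 + t * card (shadow H))"
        by (simp only: of_nat_le_iff)
      then have "real (card H) \<le> real (card H1) + real t * real (card (shadow H))" by simp
      with big tsh have h1: "\<epsilon> / 2 * real n ^ 2 \<le> real (card H1)" by simp
      have "real (card H1) \<le> real (D * card (shadow H1))"
        using HD[OF H1(1)] by (simp only: of_nat_le_iff)
      then have "\<epsilon> / 2 * real n ^ 2 \<le> real D * real (card (shadow H1))" using h1 by simp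
      then have dense: "\<delta> * real n ^ 2 \<le> real (card (shadow H1))"
        using D by (simp add: \<delta>_def field_simps)
      have sh1: "p \<subseteq> {..<n} \<and> card p = 2" if "p \<in> shadow H1" for p
      proof -
        from that obtain t where t: "t \<in> H1" "p \<subseteq> t" "card p = 2" by (auto simp: shadow_def)
        then have "t \<subseteq> {..<n}" using H1(1) unfolding H_def triangles_def by blast
        with t show ?thesis by blast
      qed
      let ?P = "{(u, v). u < n \<and> v < n \<and> {u, v} \<in> shadow H1}"
      have "card (shadow H1) \<le> card ?P" using card_pairs_le(2)[OF sh1] .
      then have dP: "\<delta> * real n ^ 2 \<le> real (card ?P)" using dense by linarith
      have "n1 \<le> n" using n by (simp add: n0_def)
      moreover have "?P \<subseteq> {..<n} \<times> {..<n}" by auto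
      ultimately have "\<exists>X Y. finite X \<and> finite Y \<and> S \<le> card X \<and> S \<le> card Y \<and> X \<times> Y \<subseteq> ?P"
        using dP by (rule n1[rule_format])
      then obtain X Y where XY: "finite X" "finite Y" "S \<le> card X" "S \<le> card Y" "X \<times> Y \<subseteq> ?P"
        by blast
      have "\<forall>x\<in>X. \<forall>y\<in>Y. colink H1 x y \<noteq> {}"
      proof (intro ballI)
        fix x y assume "x \<in> X" "y \<in> Y"
        then have p: "{x, y} \<in> shadow H1" using XY(5) by blast
        then have "x \<noteq> y" using sh1 by fastforce
        then show "colink H1 x y \<noteq> {}" using p shadow_colink(1)[OF ts1] by blast
      qed
      then have "\<exists>h. embeds V E H1 h" using S ts1 H1(2) XY(1-4) by blast
      with none[OF H1(1)] show False by blast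
    qed
    then show "real (card (triangles {..<n} G))
        \<le> real (crosscut V E - 1) * real n ^ 2 / 4 + \<epsilon> * real n ^ 2"
      by (simp add: H_def I(3) t_def)
  qed
qed

section \<open>Lower bound and conclusion\<close>

text \<open>\<open>Max\<close> ranges over a finite set, which is nonempty because the edgeless
  graph cannot accommodate an edge of the forbidden graph.\<close>

lemma ex_K3_bounds:
  assumes "EF \<noteq> {}"
  shows "graph {..<n} G \<Longrightarrow> \<not> contains_copy VF EF {..<n} G \<Longrightarrow> card (triangles {..<n} G) \<le> ex_K3 n VF EF"
    "\<exists>G. graph {..<n} G \<and> \<not> contains_copy VF EF {..<n} G \<and> ex_K3 n VF EF = card (triangles {..<n} G)"
proof -
  let ?S = "{card (triangles {..<n} E) | E. graph {..<n} E \<and> \<not> contains_copy VF EF {..<n} E}"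
  have "?S \<subseteq> (\<lambda>E. card (triangles {..<n} E)) ` Pow (Pow {..<n})" by (auto simp: graph_def)
  then have fS: "finite ?S" by (rule finite_subset) simp
  show "card (triangles {..<n} G) \<le> ex_K3 n VF EF"
    if "graph {..<n} G" "\<not> contains_copy VF EF {..<n} G"
    unfolding ex_K3_def using fS that by (intro Max_ge) auto
  have "graph {..<n} {}" "\<not> contains_copy VF EF {..<n} {}"
    using assms by (auto simp: graph_def contains_copy_def)
  then have "?S \<noteq> {}" by blast
  with fS have "ex_K3 n VF EF \<in> ?S" unfolding ex_K3_def by (rule Max_in)
  then show "\<exists>G. graph {..<n} G \<and> \<not> contains_copy VF EF {..<n} G \<and>
      ex_K3 n VF EF = card (triangles {..<n} G)" by auto
qed

section \<open>The tripartite construction\<close>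

definition part :: "nat \<Rightarrow> nat \<Rightarrow> nat \<Rightarrow> nat" where
  "part n t x = (if x < t then 0 else if x < t + (n - t) div 2 then 1 else 2)"

text \<open>This is the graph of \<open>S_edges\<close> with the clique replaced by an independent
  set.\<close>

definition tripartite_edges :: "nat \<Rightarrow> nat \<Rightarrow> nat set set" where
  "tripartite_edges n t = {{x, y} | x y. x < n \<and> y < n \<and> part n t x \<noteq> part n t y}"

lemma tripartite_edges_iff:
  "{x, y} \<in> tripartite_edges n t \<longleftrightarrow> x < n \<and> y < n \<and> part n t x \<noteq> part n t y"
  by (auto simp: tripartite_edges_def doubleton_eq_iff)

lemma S_edges_iff:
  "{x, y} \<in> S_edges n t \<longleftrightarrow>
     x < n \<and> y < n \<and> x \<noteq> y \<and> (part n t x \<noteq> part n t y \<or> x < t \<and> y < t)"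
proof -
  let ?A = "{t..<t + (n - t) div 2}" and ?B = "{t + (n - t) div 2..<n}"
  have "{x, y} \<in> S_edges n t \<longleftrightarrow> x < n \<and> y < n \<and> x \<noteq> y \<and>
      \<not> (x \<in> ?A \<and> y \<in> ?A) \<and> \<not> (x \<in> ?B \<and> y \<in> ?B)"
    unfolding S_edges_def Let_def by (auto simp: doubleton_eq_iff)
  then show ?thesis by (auto simp: part_def)
qed

text \<open>Tree vertices in part 0 form an independent set \<open>I\<close>. The ends of an edge
  missing \<open>I\<close> occupy parts 1 and 2, which forces its apex into part 0. So part 0 would
  hold at least \<open>crosscut V E\<close> vertices, but it has at most \<open>t\<close>.\<close>

lemma tripartite_free:
  assumes T: "tree V E" "E \<noteq> {}" and t: "t < crosscut V E"
  shows "\<not> contains_copy (tri_blowup_V V E) (tri_blowup_E V E) {..<n} (tripartite_edges n t)"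
proof
  assume "contains_copy (tri_blowup_V V E) (tri_blowup_E V E) {..<n} (tripartite_edges n t)"
  then obtain f where inj: "inj_on f (tri_blowup_V V E)"
    and edge: "\<And>e. e \<in> tri_blowup_E V E \<Longrightarrow> f ` e \<in> tripartite_edges n t"
    unfolding contains_copy_def by blast
  have fV: "finite V" and gr: "graph V E" using T(1) by (auto simp: tree_def)
  have fE: "finite E"
    by (rule finite_subset[of _ "Pow V"]) (use gr fV in \<open>auto simp: graph_def\<close>)
  define c where "c z = part n t (f z)" for z
  have distinct: "c (Inl u) \<noteq> c (Inl v)" "c (Inl u) \<noteq> c (Inr {u, v})" "c (Inl v) \<noteq> c (Inr {u, v})"
    if uv: "{u, v} \<in> E" for u v
  proof -
    have "{Inl u, Inl v} \<in> tri_blowup_E V E" "{Inl u, Inr {u, v}} \<in> tri_blowup_E V E"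
      "{Inl v, Inr {u, v}} \<in> tri_blowup_E V E"
      using uv by (auto simp: tri_blowup_E_def intro!: bexI[OF _ uv])
    from this[THEN edge] show "c (Inl u) \<noteq> c (Inl v)" "c (Inl u) \<noteq> c (Inr {u, v})"
      "c (Inl v) \<noteq> c (Inr {u, v})"
      by (auto simp: tripartite_edges_iff c_def)
  qed
  define I where "I = {v \<in> V. c (Inl v) = 0}"
  have ind: "independent V E I"
    unfolding independent_def
  proof (intro conjI ballI notI)
    fix x y assume "x \<in> I" "y \<in> I" "{x, y} \<in> E"
    then show False using distinct(1)[of x y] by (simp add: I_def)
  qed (auto simp: I_def)
  define M where "M = {e \<in> E. e \<inter> I = {}}"
  have M0: "c (Inr e) = 0" if e: "e \<in> M" for e
  proof -
    have "e \<in> E" using e by (simp add: M_def)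
    then obtain u v where uv: "e = {u, v}" "u \<in> V" "v \<in> V" using gr by (fastforce simp: graph_def card_2_iff)
    have "c (Inl u) \<noteq> 0" "c (Inl v) \<noteq> 0" using e uv by (auto simp: M_def I_def)
    moreover have "c z \<in> {0, 1, 2}" for z by (simp add: c_def part_def)
    ultimately show ?thesis using distinct[of u v] \<open>e \<in> E\<close> uv(1)
      by (metis empty_iff insert_iff)
  qed
  let ?Z = "Inl ` I \<union> Inr ` M"
  have "?Z \<subseteq> tri_blowup_V V E" by (auto simp: tri_blowup_V_def I_def M_def)
  then have "inj_on f ?Z" using inj by (rule inj_on_subset[rotated])
  moreover have "f ` ?Z \<subseteq> {..<t}"
  proof (intro image_subsetI)
    fix z assume "z \<in> ?Z"
    then have "c z = 0" using M0 by (auto simp: I_def)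
    then show "f z \<in> {..<t}" by (auto simp: c_def part_def split: if_splits)
  qed
  ultimately have "card ?Z \<le> card {..<t}" by (intro card_inj_on_le) auto
  moreover have "card ?Z = card I + card M"
    using fV fE by (subst card_Un_disjoint) (auto simp: card_image I_def M_def)
  moreover have "weight I V E = card I + card M"
  proof -
    have "V \<inter> I = I" by (auto simp: I_def)
    then show ?thesis by (simp add: weight_def M_def)
  qed
  ultimately show False using crosscut_props(1)[OF T ind] t by simp
qed

text \<open>A lost triangle has two vertices in the clique, which leaves at most
  \<open>t * t * n\<close> choices.\<close>

lemma card_S_bi_le:
  "card (S_bi n t) \<le> card (triangles {..<n} (tripartite_edges n t)) + t * t * n"
proof -
  let ?K = "(\<lambda>(x, y, z). {x, y, z}) ` ({..<t} \<times> {..<t} \<times> {..<n})"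
  have "S_bi n t \<subseteq> triangles {..<n} (tripartite_edges n t) \<union> ?K"
  proof
    fix s assume "s \<in> S_bi n t"
    then have s: "s \<subseteq> {..<n}" "card s = 3" "\<And>x y. x \<in> s \<Longrightarrow> y \<in> s \<Longrightarrow> x \<noteq> y \<Longrightarrow> {x, y} \<in> S_edges n t"
      by (auto simp: S_bi_def triangles_def)
    show "s \<in> triangles {..<n} (tripartite_edges n t) \<union> ?K"
    proof (cases "\<exists>x\<in>s. \<exists>y\<in>s. x \<noteq> y \<and> x < t \<and> y < t")
      case True
      then obtain x y where xy: "x \<in> s" "y \<in> s" "x \<noteq> y" "x < t" "y < t" by blast
      have "card (s - {x, y}) = 1" using s(2) xy by (simp add: card_Diff_subset)
      then obtain z where z: "s - {x, y} = {z}" by (auto simp: card_1_singleton_iff)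
      then have "s = {x, y, z}" "z < n" using xy s(1) by blast+
      then have "s \<in> ?K" using xy by (intro image_eqI[of _ _ "(x, y, z)"]) auto
      then show ?thesis ..
    next
      case False
      then have "{x, y} \<in> tripartite_edges n t" if "x \<in> s" "y \<in> s" "x \<noteq> y" for x y
        using s(3)[OF that] that by (auto simp: tripartite_edges_iff S_edges_iff)
      then show ?thesis using s(1,2) by (simp add: triangles_def)
    qed
  qed
  moreover have "finite (triangles {..<n} (tripartite_edges n t))"
    using triangles_triple_system[of "{..<n}"] by (simp add: triple_system_def)
  ultimately have "card (S_bi n t) \<le> card (triangles {..<n} (tripartite_edges n t) \<union> ?K)"
    by (intro card_mono) auto
  also have "\<dots> \<le> card (triangles {..<n} (tripartite_edges n t)) + card ?K" by (rule card_Un_le)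
  also have "card ?K \<le> card ({..<t} \<times> {..<t} \<times> {..<n})" by (rule card_image_le) simp
  finally show ?thesis by (simp add: card_cartesian_product)
qed

text \<open>Only the triangles with one vertex in the clique and one in each half are counted; the
  subtracted 1 accounts for odd \<open>n - t\<close>.\<close>

lemma card_S_bi_ge:
  assumes "t \<le> n"
  shows "real t * ((real n - real t) ^ 2 - 1) / 4 \<le> real (card (S_bi n t))"
proof -
  define m where "m = (n - t) div 2"
  let ?A = "{t..<t + m}" and ?B = "{t + m..<n}"
  let ?f = "\<lambda>(x, a, b). {x, a, b}"
  have le: "t + m \<le> n" using assms by (simp add: m_def)
  have "inj_on ?f ({..<t} \<times> ?A \<times> ?B)"
  proof (rule inj_onI)
    fix p q assume p: "p \<in> {..<t} \<times> ?A \<times> ?B" and q: "q \<in> {..<t} \<times> ?A \<times> ?B" and eq: "?f p = ?f q"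
    obtain x a b x' a' b' where pq: "p = (x, a, b)" "q = (x', a', b')" by (cases p, cases q) auto
    have "{x, a, b} \<inter> {..<t} = {x}" "{x, a, b} \<inter> ?A = {a}" "{x, a, b} \<inter> ?B = {b}"
      using p pq by auto
    moreover have "{x', a', b'} \<inter> {..<t} = {x'}" "{x', a', b'} \<inter> ?A = {a'}" "{x', a', b'} \<inter> ?B = {b'}"
      using q pq by auto
    moreover have "{x, a, b} = {x', a', b'}" using eq pq by simp
    ultimately show "p = q" using pq by auto
  qed
  moreover have "?f ` ({..<t} \<times> ?A \<times> ?B) \<subseteq> S_bi n t"
  proof (intro image_subsetI)
    fix p assume p: "p \<in> {..<t} \<times> ?A \<times> ?B"
    obtain x a b where pq: "p = (x, a, b)" by (cases p) auto
    have o: "x < t" "t \<le> a" "a < t + m" "t + m \<le> b" "b < n" using p pq by auto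
    then have "part n t x = 0" "part n t a = 1" "part n t b = 2" by (auto simp: part_def m_def)
    moreover have "x < n" "a < n" "x \<noteq> a" "x \<noteq> b" "a \<noteq> b" using o by auto
    ultimately show "?f p \<in> S_bi n t"
      using o(5) by (auto simp: pq S_bi_def triangles_def S_edges_iff)
  qed
  moreover have "finite (S_bi n t)"
    using triangles_triple_system[of "{..<n}"] by (simp add: S_bi_def triple_system_def)
  ultimately have "card ({..<t} \<times> ?A \<times> ?B) \<le> card (S_bi n t)" by (intro card_inj_on_le)
  then have "t * (m * (n - (t + m))) \<le> card (S_bi n t)" by (simp add: card_cartesian_product)
  then have ge: "real t * (real m * (real n - real t - real m)) \<le> real (card (S_bi n t))"
    using le by (metis (no_types, lifting) diff_diff_eq of_nat_add of_nat_diff of_nat_le_iff of_nat_mult)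
  have "real n - real t = 2 * real m \<or> real n - real t = 2 * real m + 1"
  proof -
    have "n - t = 2 * m \<or> n - t = 2 * m + 1" unfolding m_def by linarith
    then show ?thesis using assms by linarith
  qed
  then have "((real n - real t) ^ 2 - 1) / 4 \<le> real m * (real n - real t - real m)"
  proof
    assume "real n - real t = 2 * real m"
    then show ?thesis by (simp add: power2_eq_square)
  next
    assume e: "real n - real t = 2 * real m + 1"
    show ?thesis unfolding e by (simp add: power2_eq_square algebra_simps)
  qed
  then have "real t * (((real n - real t) ^ 2 - 1) / 4) \<le> real t * (real m * (real n - real t - real m))"
    by (rule mult_left_mono) simp
  with ge show ?thesis by simp
qed

theorem theorem1p6:
  fixes V :: "'a set" and E :: "'a set set"
  assumes "tree V E" and "E \<noteq> {}"
  shows "(\<lambda>n. real (ex_K3 n (tri_blowup_V V E) (tri_blowup_E V E))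
              - real (card (S_bi n (crosscut V E - 1))))
         \<in> o(\<lambda>n. real n ^ 2)"
proof (rule landau_o.smallI)
  fix c :: real assume c: "c > 0"
  define t where "t = crosscut V E - 1"
  let ?ex = "\<lambda>n. ex_K3 n (tri_blowup_V V E) (tri_blowup_E V E)"
  \<comment> \<open>A nonempty optimal set makes the crosscut number positive, so the truncated
    subtraction in \<open>t\<close> is a true one.\<close>
  obtain I where I: "I \<noteq> {}" "independent V E I" "crosscut V E = weight I V E"
    using crosscut_props(2)[OF assms] by blast
  have "V \<inter> I = I" "finite V" using I(2) assms(1) by (auto simp: independent_def tree_def)
  then have "card (V \<inter> I) > 0" using I(1) by (metis card_gt_0_iff finite_Int)
  then have t: "t < crosscut V E" using I(3) by (simp add: t_def weight_def)
  have ne: "tri_blowup_E V E \<noteq> {}" using assms(2) by (auto simp: tri_blowup_E_def)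
  obtain n0 where n0: "\<And>n G. n0 \<le> n \<Longrightarrow>
      \<not> contains_copy (tri_blowup_V V E) (tri_blowup_E V E) {..<n} G \<Longrightarrow>
      real (card (triangles {..<n} G)) \<le> real t * real n ^ 2 / 4 + c / 2 * real n ^ 2"
    using triangles_upper_bound[OF assms, of "c / 2"] c unfolding t_def by auto
  \<comment> \<open>From \<open>n1\<close> on, the linear error terms, bounded by
    \<open>(t + 1) * (t + 1) * n\<close>, are at most \<open>c / 2 * n^2\<close>.\<close>
  define n1 where "n1 = n0 + t + nat \<lceil>real (2 * (t + 1) * (t + 1)) / c\<rceil> + 1"
  have "norm (real (?ex n) - real (card (S_bi n t))) \<le> c * norm (real n ^ 2)" if n: "n1 \<le> n" for n
  proof -
    have "real (2 * (t + 1) * (t + 1)) / c \<le> real n" using n unfolding n1_def by linarith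
    then have "real (2 * (t + 1) * (t + 1)) \<le> c * real n" using c by (simp add: field_simps)
    then have "real (2 * (t + 1) * (t + 1)) * real n \<le> c * real n * real n"
      by (rule mult_right_mono) simp
    then have small: "2 * ((real t + 1) * (real t + 1) * real n) \<le> c * real n ^ 2"
      by (simp add: power2_eq_square algebra_simps)
    have n': "n0 \<le> n" "t \<le> n" "1 \<le> n" using n by (simp_all add: n1_def)
    have "real (?ex n) \<le> real t * real n ^ 2 / 4 + c / 2 * real n ^ 2"
      using ex_K3_bounds(2)[OF ne, of n "tri_blowup_V V E"] n0[OF n'(1)] by metis
    moreover have "real t * real n ^ 2 / 4 - real (card (S_bi n t)) \<le> (real t + 1) * (real t + 1) * real n"
    proof -
      have "real t * ((real n - real t) ^ 2 - 1) / 4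
          = real t * real n ^ 2 / 4 - real t * (2 * real n * real t + 1 - real t * real t) / 4"
        by (simp add: power2_eq_square field_simps)
      moreover have "real t * (2 * real n * real t + 1 - real t * real t) / 4
          \<le> (real t + 1) * (real t + 1) * real n"
      proof -
        have "real t * (2 * real n * real t + 1 - real t * real t) \<le> real t * (2 * real n * real t + real n)"
        proof (rule mult_left_mono)
          have "0 \<le> real t * real t" "1 \<le> real n" using n'(3) by simp_all
          then show "2 * real n * real t + 1 - real t * real t \<le> 2 * real n * real t + real n"
            by linarith
        qed simp
        also have "\<dots> \<le> 4 * ((real t + 1) * (real t + 1) * real n)"
          by (simp add: algebra_simps)
        finally show ?thesis by simp
      qed
      ultimately show ?thesis using card_S_bi_ge[OF n'(2)] by linarith
    qed
    moreover have "real (card (S_bi n t)) \<le> real (?ex n) + (real t + 1) * (real t + 1) * real n"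
    proof -
      have gr: "graph {..<n} (tripartite_edges n t)"
        by (auto simp: graph_def tripartite_edges_def card_2_iff)
      have "card (S_bi n t) \<le> ?ex n + t * t * n"
        using card_S_bi_le[of n t] ex_K3_bounds(1)[OF ne gr tripartite_free[OF assms t]] by linarith
      also have "\<dots> \<le> ?ex n + (t + 1) * (t + 1) * n" by (intro add_left_mono mult_right_mono mult_mono) auto
      finally have "real (card (S_bi n t)) \<le> real (?ex n + (t + 1) * (t + 1) * n)"
        by (simp only: of_nat_le_iff)
      then show ?thesis by (simp add: algebra_simps)
    qed
    ultimately have "\<bar>real (?ex n) - real (card (S_bi n t))\<bar> \<le> c * real n ^ 2"
      using small by linarith
    then show ?thesis by simp
  qed
  then show "\<forall>\<^sub>F n in sequentially. norm (real (?ex n) - real (card (S_bi n (crosscut V E - 1))))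
      \<le> c * norm (real n ^ 2)"
    unfolding t_def by (auto simp: eventually_at_top_linorder intro: exI[of _ n1])
qed

end
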